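(* Fix $\sigma>0$. Then the desymmetrized Robin spectrum on the hemisphere is simple: $\lambda_m(\sigma)\ne\lambda_n(\sigma)$ for all $n\neq m$.
   Context: Let $\Omega$ be the closed upper unit hemisphere in $\mathbb R^3$ with coordinates $(\sin\theta\cos\phi,\sin\theta\sin\phi,\cos\theta)$, $0\le\theta\le\pi/2$, $0\le \phi<2\pi$, and boundary the equator $\theta=\pi/2$. For a constant $\sigma>0$ the Robin problem is $\Delta F+\lambda F=0$ in $\Omega$, $\frac{\partial F}{\partial n}+\sigma F=0$ on $\partial\Omega$, where $\Delta$ is the Laplace-Beltrami operator and $\partial/\partial n$ the outward normal derivative. It separates into sectors of functions $F=e^{ik\phi}f(\cos\theta)$, $k\in\mathbb Z$; since $\pm k$ give the same eigenvalues, the desymmetrized spectrum keeps only the eigenvalues of sectors with $k\ge0$ (an eigenvalue is counted once for each $k\ge 0$ for which it has a nonzero eigenfunction in sector $k$; the eigenspaces within a sector are one-dimensional). Let $\lambda_0(\sigma)\le\lambda_1(\sigma)\le\cdots$ be the ordered desymmetrized Robin eigenvalues, repeated with multiplicity. *)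

theory Defs
  imports "HOL-Analysis.Analysis"
begin

definition hemisphere :: "(real^3) set" where
  "hemisphere = {x. norm x = 1 \<and> 0 \<le> x $ 3}"

definition equator :: "(real^3) set" where
  "equator = {x. norm x = 1 \<and> x $ 3 = 0}"

definition sph :: "real \<Rightarrow> real \<Rightarrow> real^3" where
  "sph \<theta> \<phi> = vector [sin \<theta> * cos \<phi>, sin \<theta> * sin \<phi>, cos \<theta>]"

definition partial_deriv ::
  "'a::real_normed_vector \<Rightarrow> ('a \<Rightarrow> 'b::real_normed_vector) \<Rightarrow> 'a \<Rightarrow> 'b" where
  "partial_deriv b G x = frechet_derivative G (at x) b"

text \<open>Twice continuously differentiable; meant for open \<open>S\<close>.\<close>

definition C2_on ::
  "'a::euclidean_space set \<Rightarrow> ('a \<Rightarrow> 'b::real_normed_vector) \<Rightarrow> bool" where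
  "C2_on S G \<longleftrightarrow>
     G differentiable_on S \<and>
     (\<forall>b\<in>Basis. partial_deriv b G differentiable_on S) \<and>
     (\<forall>b\<in>Basis. \<forall>c\<in>Basis. continuous_on S (partial_deriv c (partial_deriv b G)))"

definition laplacian ::
  "('a::euclidean_space \<Rightarrow> 'b::real_normed_vector) \<Rightarrow> 'a \<Rightarrow> 'b" where
  "laplacian G x = (\<Sum>b\<in>Basis. partial_deriv b (partial_deriv b G) x)"

text \<open>
  Functions on the hemisphere are represented by functions on the ambient space, of which only
  the values on \<open>hemisphere\<close> matter.  The Laplace-Beltrami operator of the unit sphere is the
  Euclidean Laplacian of the extension that is constant along rays, \<open>y \<mapsto> F (y / norm y)\<close>
  (recall \<open>sgn y = y /\<^sub>R norm y\<close>): in spherical coordinates the Euclidean Laplacian is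
  \<open>r\<^sup>-\<^sup>2 \<partial>\<^sub>r (r\<^sup>2 \<partial>\<^sub>r) + r\<^sup>-\<^sup>2 \<Delta>\<close>.  Unlike the coordinate formula for \<open>\<Delta>\<close>, this is also meaningful at
  the pole.
\<close>

definition laplace_beltrami :: "(real^3 \<Rightarrow> complex) \<Rightarrow> real^3 \<Rightarrow> complex" where
  "laplace_beltrami F x = laplacian (\<lambda>y. F (sgn y)) x"

text \<open>
  At a point \<open>p\<close> of the equator the outward unit normal is \<open>n = - axis 3 1\<close>, and
  \<open>t \<mapsto> cos t *\<^sub>R p + sin t *\<^sub>R n\<close> is the geodesic through \<open>p\<close> with velocity \<open>n\<close>.  It runs inside the
  hemisphere for small \<open>t \<le> 0\<close>, whence the one-sided derivative.
\<close>

definition has_normal_derivative ::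
  "(real^3 \<Rightarrow> complex) \<Rightarrow> complex \<Rightarrow> real^3 \<Rightarrow> bool" where
  "has_normal_derivative F D p \<longleftrightarrow>
     ((\<lambda>t. F (cos t *\<^sub>R p + sin t *\<^sub>R (- axis 3 1))) has_vector_derivative D) (at 0 within {..0})"

text \<open>
  Classical solutions: twice continuously differentiable in the interior of the hemisphere
  (expressed for the extension along rays, on the open half-space) and continuous up to the
  boundary, with a normal derivative there.
\<close>

definition robin_solution :: "real \<Rightarrow> real \<Rightarrow> (real^3 \<Rightarrow> complex) \<Rightarrow> bool" where
  "robin_solution \<sigma> \<mu> F \<longleftrightarrow>
     continuous_on hemisphere F \<and>
     C2_on {y. 0 < y $ 3} (\<lambda>y. F (sgn y)) \<and>
     (\<forall>x\<in>hemisphere - equator. laplace_beltrami F x + of_real \<mu> * F x = 0) \<and>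
     (\<forall>p\<in>equator. \<exists>D. has_normal_derivative F D p \<and> D + of_real \<sigma> * F p = 0)"

definition in_sector :: "int \<Rightarrow> (real^3 \<Rightarrow> complex) \<Rightarrow> bool" where
  "in_sector k F \<longleftrightarrow>
     (\<exists>f::real \<Rightarrow> complex. \<forall>\<theta>\<in>{0..pi/2}. \<forall>\<phi>\<in>{0..<2*pi}.
        F (sph \<theta> \<phi>) = exp (\<i> * of_int k * of_real \<phi>) * f (cos \<theta>))"

definition sector_eigenvalue :: "real \<Rightarrow> int \<Rightarrow> real \<Rightarrow> bool" where
  "sector_eigenvalue \<sigma> k \<mu> \<longleftrightarrow>
     (\<exists>F. robin_solution \<sigma> \<mu> F \<and> in_sector k F \<and> (\<exists>x\<in>hemisphere. F x \<noteq> 0))"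

text \<open>
  The pairs \<open>(k, \<mu>)\<close> record the multiplicity: \<open>\<mu>\<close> counts once for every sector \<open>k \<ge> 0\<close> in which it
  is an eigenvalue.
\<close>

definition desym_spectrum :: "real \<Rightarrow> (int \<times> real) set" where
  "desym_spectrum \<sigma> = {(k, \<mu>). 0 \<le> k \<and> sector_eigenvalue \<sigma> k \<mu>}"

definition ordered_desym_eigenvalues :: "real \<Rightarrow> (nat \<Rightarrow> real) \<Rightarrow> bool" where
  "ordered_desym_eigenvalues \<sigma> ev \<longleftrightarrow>
     mono ev \<and> (\<exists>k. bij_betw (\<lambda>n. (k n, ev n)) UNIV (desym_spectrum \<sigma>))"

end

theory Submission
  imports Defs
begin

text \<open>
  The eigenfunction of sector \<open>k\<close>, followed along a meridian with the coordinate \<open>t \<ge> 0\<close> given by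
  \<open>cos \<theta> = tanh t\<close> (the equator is \<open>t = 0\<close>, the pole \<open>t = \<infinity>\<close>), solves
  \<open>y'' = (k\<^sup>2 - \<mu> / cosh\<^sup>2 t) y\<close>, converges with \<open>y' \<rightarrow> 0\<close> as \<open>t \<rightarrow> \<infinity>\<close>, and the Robin condition reads
  \<open>y'(0) = \<sigma> y(0)\<close>.  Such solutions are called regular modes below.  Since the Wronskian of two
  regular modes is constant and vanishes at infinity, \<open>k\<close> and \<open>\<mu>\<close> determine the slope \<open>y'(0) / y(0)\<close>.
  
  Different sectors with the same \<open>\<mu>\<close> are linked by the raising operator of angular momentum:
  \<open>cosh t (y' + k tanh t y)\<close> is a regular mode of sector \<open>k + 1\<close>, and it maps the data
  \<open>(y(0), y'(0)) = (a, b)\<close> to \<open>(b, - c\<^sub>k a)\<close> with \<open>c\<^sub>k = \<mu> - k (k + 1)\<close>.  The slope \<open>r\<close> thus becomes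
  \<open>- c\<^sub>k / r\<close>, and two steps turn \<open>r\<close> into \<open>r c\<^bsub>k+1\<^esub> / c\<^sub>k\<close>.  As \<open>c\<^sub>k\<close> strictly decreases in \<open>k\<close>, after an
  odd number of steps from the positive slope \<open>\<sigma>\<close> the slope is negative, and after an even positive
  number it is strictly below \<open>\<sigma>\<close>, provided that all the \<open>c\<^sub>k\<close> involved are positive.
  This last condition is automatic: \<open>\<sigma> > 0\<close> forces \<open>\<mu> > k (k + 1)\<close> in every sector \<open>k\<close> with Robin
  eigenvalue \<open>\<mu>\<close>, by monotonicity of \<open>y (y' + k tanh t y)\<close>.
  So if \<open>\<mu>\<close> were an eigenvalue in sectors \<open>k < k'\<close>, raising the mode of sector \<open>k\<close> up to \<open>k'\<close> would
  give a regular mode of sector \<open>k'\<close> whose slope is not \<open>\<sigma>\<close>, against uniqueness of the slope.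
\<close>

section \<open>Monotonicity up to an endpoint or to infinity\<close>

lemma nonneg_derivative_imp_le:
  fixes h :: "real \<Rightarrow> real"
  assumes "a \<le> b" "continuous_on {a..} h"
    and "\<And>t. a < t \<Longrightarrow> (h has_real_derivative h' t) (at t)" "\<And>t. a < t \<Longrightarrow> 0 \<le> h' t"
  shows "h a \<le> h b"
proof (cases "a < b")
  case True
  show ?thesis
  proof (rule DERIV_nonneg_imp_increasing_open[of a b h])
    show "a \<le> b" by fact
    show "\<exists>y. (h has_real_derivative y) (at x) \<and> 0 \<le> y" if "a < x" "x < b" for x
      using assms(3,4) that by blast
    show "continuous_on {a..b} h"
      using assms(2) by (rule continuous_on_subset) auto
  qed
qed (use assms in auto)

lemma nonneg_derivative_imp_le_limit:
  fixes h :: "real \<Rightarrow> real"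
  assumes "continuous_on {a..} h"
    and "\<And>t. a < t \<Longrightarrow> (h has_real_derivative h' t) (at t)" "\<And>t. a < t \<Longrightarrow> 0 \<le> h' t"
    and "(h \<longlongrightarrow> l) at_top"
  shows "h a \<le> l"
proof (rule tendsto_lowerbound[OF assms(4)])
  show "\<forall>\<^sub>F t in at_top. h a \<le> h t"
    using eventually_ge_at_top[of a]
    by eventually_elim (rule nonneg_derivative_imp_le[OF _ assms(1-3)])
qed simp

section \<open>Regular modes of a sector\<close>

text \<open>
  The condition \<open>real k * L = 0\<close> says that the limit at the pole vanishes in every sector but the
  rotationally symmetric one.  Limits of \<open>y\<close> and \<open>z\<close>, rather than the rate of decay \<open>exp (- k t)\<close>, are what
  makes Wronskians vanish at infinity.  The function \<open>z\<close>, the derivative of \<open>y\<close>, is a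
  separate argument because \<open>y\<close> is only considered on \<open>t \<ge> 0\<close>; the value \<open>z 0\<close> is the one-sided derivative.
\<close>

definition regular_mode :: "nat \<Rightarrow> real \<Rightarrow> (real \<Rightarrow> real) \<Rightarrow> (real \<Rightarrow> real) \<Rightarrow> bool" where
  "regular_mode k \<mu> y z \<longleftrightarrow>
     continuous_on {0..} y \<and> continuous_on {0..} z \<and>
     (\<forall>t>0. (y has_real_derivative z t) (at t)) \<and>
     (\<forall>t>0. (z has_real_derivative ((real k)\<^sup>2 - \<mu> / (cosh t)\<^sup>2) * y t) (at t)) \<and>
     (\<exists>L. (y \<longlongrightarrow> L) at_top \<and> real k * L = 0) \<and> (z \<longlongrightarrow> 0) at_top"

text \<open>
  Uniqueness for the initial value problem, by Gronwall's argument: the energy \<open>y\<^sup>2 + z\<^sup>2\<close> grows at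
  most at the rate \<open>M\<close>, because the coefficient \<open>k\<^sup>2 - \<mu> / cosh\<^sup>2 t\<close> is bounded.
\<close>

lemma regular_mode_zero_data:
  assumes "regular_mode k \<mu> y z" "y 0 = 0" "z 0 = 0" "0 \<le> t"
  shows "y t = 0"
proof -
  define M where "M = 1 + (real k)\<^sup>2 + \<bar>\<mu>\<bar>"
  define E where "E = (\<lambda>t. - ((y t)\<^sup>2 + (z t)\<^sup>2) * exp (- M * t))"
  define q where "q = (\<lambda>t. (real k)\<^sup>2 - \<mu> / (cosh t)\<^sup>2)"
  define E' where "E' = (\<lambda>t. (M * ((y t)\<^sup>2 + (z t)\<^sup>2) - 2 * y t * z t * (1 + q t)) * exp (- M * t))"
  have "E 0 \<le> E t"
  proof (rule nonneg_derivative_imp_le[where h = E and h' = E' and a = 0])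
    show "0 \<le> t" by fact
    show "continuous_on {0..} E"
      unfolding E_def using assms(1) by (auto simp: regular_mode_def intro!: continuous_intros)
    show "(E has_real_derivative E' t) (at t)" if "0 < t" for t
    proof -
      have [derivative_intros]: "(y has_real_derivative z t) (at t)"
        "(z has_real_derivative q t * y t) (at t)"
        using assms(1) that by (auto simp: regular_mode_def q_def)
      show ?thesis
        unfolding E_def E'_def
        by (auto intro!: derivative_eq_intros simp: algebra_simps power2_eq_square)
    qed
    show "0 \<le> E' t" if "0 < t" for t
    proof -
      have "(cosh t)\<^sup>2 \<ge> 1" using cosh_real_ge_1[of t] by (simp add: one_le_power)
      then have "\<bar>\<mu> / (cosh t)\<^sup>2\<bar> \<le> \<bar>\<mu>\<bar>"
        by (simp add: abs_div divide_le_eq mult_left_le mult_le_cancel_left1)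
      then have q: "\<bar>1 + q t\<bar> \<le> M" unfolding q_def M_def by (smt (verit) zero_le_power2)
      have "2 * y t * z t * (1 + q t) \<le> \<bar>2 * y t * z t\<bar> * \<bar>1 + q t\<bar>"
        by (metis abs_ge_self abs_mult)
      also have "\<dots> \<le> \<bar>2 * y t * z t\<bar> * M" using q by (intro mult_left_mono) auto
      also have "\<dots> \<le> ((y t)\<^sup>2 + (z t)\<^sup>2) * M"
      proof (rule mult_right_mono)
        show "\<bar>2 * y t * z t\<bar> \<le> (y t)\<^sup>2 + (z t)\<^sup>2"
          using sum_squares_bound[of "y t" "z t"] sum_squares_bound[of "- y t" "z t"]
          by (auto simp: abs_if)
        show "0 \<le> M" by (auto simp: M_def)
      qed
      finally show ?thesis unfolding E'_def by (simp add: mult.commute)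
    qed
  qed
  then have "((y t)\<^sup>2 + (z t)\<^sup>2) * exp (- M * t) \<le> 0"
    using assms(2,3) unfolding E_def by (simp add: algebra_simps)
  then have "(y t)\<^sup>2 + (z t)\<^sup>2 \<le> 0"
    using exp_gt_zero[of "- M * t"] by (auto simp: mult_le_0_iff)
  then show ?thesis by (smt (verit) zero_le_power2 power_eq_0_iff)
qed

section \<open>Raising a mode to the next sector\<close>

text \<open>
  The function \<open>w = y' + k tanh t y\<close> satisfies the first-order equation
  \<open>w' = k tanh t w + c y / cosh\<^sup>2 t\<close> with \<open>c = k (k + 1) - \<mu>\<close>.  Both the decay of the raised mode and the
  lower bound for the eigenvalue are read off from it.
\<close>

lemma has_derivative_raised:
  fixes y z :: "real \<Rightarrow> real"
  assumes "(y has_real_derivative z t) (at t)"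
    "(z has_real_derivative ((real k)\<^sup>2 - \<mu> / (cosh t)\<^sup>2) * y t) (at t)"
  shows "((\<lambda>t. z t + k * tanh t * y t) has_real_derivative
           k * tanh t * (z t + k * tanh t * y t) + (real k * (real k + 1) - \<mu>) / (cosh t)\<^sup>2 * y t) (at t)"
proof -
  have c: "cosh t \<noteq> 0" by simp
  have th: "(tanh t)\<^sup>2 = 1 - 1 / (cosh t)\<^sup>2"
  proof -
    have "(cosh t)\<^sup>2 \<noteq> 0" by simp
    then show ?thesis
      unfolding tanh_def power_divide sinh_square_eq by (simp add: diff_divide_distrib)
  qed
  have [derivative_intros]: "(tanh has_real_derivative 1 - (tanh t)\<^sup>2) (at t)"
    using has_field_derivative_tanh[of id t 1 UNIV] by (simp add: id_def)
  note assms[derivative_intros]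
  have "((\<lambda>t. z t + k * tanh t * y t) has_real_derivative
      ((real k)\<^sup>2 - \<mu> / (cosh t)\<^sup>2) * y t + (k * (1 - (tanh t)\<^sup>2) * y t + k * tanh t * z t)) (at t)"
    by (auto intro!: derivative_eq_intros simp: algebra_simps)
  moreover have "((real k)\<^sup>2 - \<mu> / (cosh t)\<^sup>2) * y t + (k * (1 - (tanh t)\<^sup>2) * y t + k * tanh t * z t)
     = k * tanh t * z t + k * k * (tanh t)\<^sup>2 * y t + (real k * (real k + 1) - \<mu>) / (cosh t)\<^sup>2 * y t"
    unfolding th by (simp add: divide_simps c) (simp add: algebra_simps power2_eq_square)
  moreover have "k * tanh t * z t + k * k * (tanh t)\<^sup>2 * y t + (real k * (real k + 1) - \<mu>) / (cosh t)\<^sup>2 * y t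
     = k * tanh t * (z t + k * tanh t * y t) + (real k * (real k + 1) - \<mu>) / (cosh t)\<^sup>2 * y t"
    by (simp add: algebra_simps power2_eq_square)
  ultimately show ?thesis by (simp only:)
qed

lemma continuous_on_tanh_real: "continuous_on A (tanh :: real \<Rightarrow> real)"
  by (intro continuous_intros) auto

text \<open>
  The raised mode is \<open>cosh t\<close> times \<open>w = y' + k tanh t y\<close>, so \<open>w \<rightarrow> 0\<close> alone would not make it decay.
  With \<open>c = k (k + 1) - \<mu>\<close>, the equation for \<open>w\<close> divided by \<open>cosh\<^sup>k t\<close> gives
  \<open>(w / cosh\<^sup>k t)' = c y / cosh\<^bsup>k+2\<^esup> t\<close>; as \<open>y\<close> is bounded and \<open>w / cosh\<^sup>k t\<close> tends to \<open>0\<close>,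
  comparison with \<open>1 / cosh\<^bsup>k+2\<^esup> t\<close>, whose logarithmic derivative is about \<open>-(k + 2)\<close>, shows that
  \<open>w / cosh\<^sup>k t\<close> is itself of this size.
\<close>

lemma raised_decay:
  assumes "regular_mode k \<mu> y z"
  obtains B where "\<forall>\<^sub>F t in at_top. \<bar>z t + k * tanh t * y t\<bar> \<le> B / (cosh t)\<^sup>2"
proof -
  define w where "w = (\<lambda>t. z t + k * tanh t * y t)"
  define c where "c = real k * (real k + 1) - \<mu>"
  define h where "h = (\<lambda>t. w t / cosh t ^ k)"
  obtain L where L: "(y \<longlongrightarrow> L) at_top" "real k * L = 0" and z: "(z \<longlongrightarrow> 0) at_top"
    using assms by (auto simp: regular_mode_def)
  have w0: "(w \<longlongrightarrow> 0) at_top"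
  proof -
    have "(w \<longlongrightarrow> 0 + real k * 1 * L) at_top"
      unfolding w_def by (intro tendsto_intros z L tanh_real_at_top)
    then show ?thesis using L(2) by simp
  qed
  have h0: "(h \<longlongrightarrow> 0) at_top"
  proof (rule tendsto_0_le[where K = 1, OF w0])
    have "1 \<le> cosh t ^ k" for t :: real by (simp add: cosh_real_ge_1 one_le_power)
    then show "\<forall>\<^sub>F t in at_top. norm (h t) \<le> norm (w t) * 1"
      by (intro always_eventually) (auto simp: h_def abs_div divide_le_eq mult_le_cancel_left1)
  qed
  have h': "(h has_real_derivative c * y t / cosh t ^ (k + 2)) (at t)" if "0 < t" for t
  proof -
    have "(w has_real_derivative k * tanh t * w t + c / (cosh t)\<^sup>2 * y t) (at t)"
      unfolding w_def c_def using assms that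
      by (intro has_derivative_raised) (auto simp: regular_mode_def)
    note [derivative_intros] = this
    have "(h has_real_derivative
        ((k * tanh t * w t + c / (cosh t)\<^sup>2 * y t) * cosh t ^ k - w t * (k * cosh t ^ (k - 1) * sinh t)) 
         / (cosh t ^ k * cosh t ^ k)) (at t)"
      unfolding h_def by (auto intro!: derivative_eq_intros)
    also have "(k * tanh t * w t + c / (cosh t)\<^sup>2 * y t) * cosh t ^ k - w t * (k * cosh t ^ (k - 1) * sinh t)
        = c / (cosh t)\<^sup>2 * y t * cosh t ^ k"
      by (cases k) (simp_all add: tanh_def field_simps)
    also have "c / (cosh t)\<^sup>2 * y t * cosh t ^ k / (cosh t ^ k * cosh t ^ k) = c * y t / cosh t ^ (k + 2)"
      by (simp add: field_simps power_add power2_eq_square)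
    finally show ?thesis .
  qed
  define B where "B = \<bar>c\<bar> * (\<bar>L\<bar> + 1)"
  have "\<forall>\<^sub>F t in at_top. \<bar>y t\<bar> < \<bar>L\<bar> + 1"
    using tendsto_rabs[OF L(1)] by (rule order_tendstoD) simp
  moreover have "\<forall>\<^sub>F t in at_top. 1/2 < tanh (t::real)"
    using tanh_real_at_top by (rule order_tendstoD) simp
  ultimately have "\<forall>\<^sub>F t in at_top. 0 < t \<and> \<bar>y t\<bar> < \<bar>L\<bar> + 1 \<and> 1/2 < tanh t"
    using eventually_gt_at_top[of 0] by eventually_elim auto
  then obtain T where T: "\<And>t. T \<le> t \<Longrightarrow> 0 < t \<and> \<bar>y t\<bar> < \<bar>L\<bar> + 1 \<and> 1/2 < tanh t"
    by (auto simp: eventually_at_top_linorder)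
  \<comment> \<open>The sign \<open>e = 1\<close> or \<open>e = -1\<close> treats the upper and the lower estimate at once; \<open>T\<close> makes \<open>(k + 2) tanh t \<ge> 1\<close>.\<close>
  have bound: "e * h t \<le> B / cosh t ^ (k + 2)" if e: "\<bar>e\<bar> = 1" and "T \<le> t" for e t
  proof -
    define H where "H = (\<lambda>t. e * h t - B * inverse (cosh t ^ (k + 2)))"
    define H' where "H' = (\<lambda>t. e * (c * y t / cosh t ^ (k + 2)) + B * (real (k + 2) * tanh t / cosh t ^ (k + 2)))"
    have "H t \<le> e * 0 - B * 0"
    proof (rule nonneg_derivative_imp_le_limit[where h = H and h' = H' and a = t])
      have D: "(H has_real_derivative H' s) (at s)" if "t \<le> s" for s
      proof -
        have "0 < s" using T[of s] that \<open>T \<le> t\<close> by simp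
        note h'[OF this, derivative_intros]
        show ?thesis
          unfolding H_def H'_def
          by (auto intro!: derivative_eq_intros simp del: power_Suc)
             (simp add: tanh_def field_simps)
      qed
      then show "(H has_real_derivative H' s) (at s)" if "t < s" for s using that by simp
      show "continuous_on {t..} H"
        using D by (intro continuous_at_imp_continuous_on ballI) (auto intro: DERIV_isCont)
      show "0 \<le> H' s" if "t < s" for s
      proof -
        have s: "0 < s" "\<bar>y s\<bar> < \<bar>L\<bar> + 1" "1/2 < tanh s"
          using T[of s] that \<open>T \<le> t\<close> by auto
        have "\<bar>e * (c * y s)\<bar> \<le> B"
          using e s unfolding B_def by (auto simp: abs_mult intro!: mult_left_mono)
        moreover have "B * 1 \<le> B * (real (k + 2) * tanh s)"
        proof (rule mult_left_mono)
          have "2 * (1/2) \<le> real (k + 2) * tanh s"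
            using s(3) by (intro mult_mono) auto
          then show "1 \<le> real (k + 2) * tanh s" by simp
          show "0 \<le> B" by (simp add: B_def)
        qed
        ultimately have "0 \<le> e * (c * y s) + B * (real (k + 2) * tanh s)" by linarith
        then have "0 \<le> (e * (c * y s) + B * (real (k + 2) * tanh s)) / cosh s ^ (k + 2)"
          by (intro divide_nonneg_nonneg) auto
        then show ?thesis unfolding H'_def by (simp add: add_divide_distrib)
      qed
      have "filterlim (\<lambda>t::real. cosh t ^ (k + 2)) at_top at_top"
        by (intro filterlim_pow_at_top cosh_real_at_top) simp
      then show "(H \<longlongrightarrow> e * 0 - B * 0) at_top"
        unfolding H_def
        by (intro tendsto_intros h0 tendsto_inverse_0_at_top)
    qed
    then show ?thesis by (simp add: H_def divide_inverse)
  qed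
  have "\<bar>w t\<bar> \<le> B / (cosh t)\<^sup>2" if "T \<le> t" for t
  proof -
    have "\<bar>h t\<bar> \<le> B / cosh t ^ (k + 2)"
      using bound[of 1 t] bound[of "-1" t] that by (auto simp: abs_le_iff)
    then have "\<bar>h t\<bar> * cosh t ^ k \<le> B / cosh t ^ (k + 2) * cosh t ^ k"
      by (rule mult_right_mono) simp
    moreover have "\<bar>h t\<bar> * cosh t ^ k = \<bar>w t\<bar>" by (simp add: h_def abs_div)
    moreover have "B / cosh t ^ (k + 2) * cosh t ^ k = B / (cosh t)\<^sup>2"
      by (simp add: power_add field_simps power2_eq_square)
    ultimately show ?thesis by (simp only:)
  qed
  then show thesis
    by (intro that[of B]) (auto simp: w_def eventually_at_top_linorder)
qed

text \<open>
  On the sphere this is the angular momentum operator \<open>exp (\<i> \<phi>) (\<partial>\<^sub>\<theta> + \<i> cot \<theta> \<partial>\<^sub>\<phi>)\<close>, up to sign, which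
  commutes with the Laplacian and shifts the sector by one.  At \<open>t = 0\<close> the new data are
  \<open>z 0\<close> and \<open>(k (k + 1) - \<mu>) y 0\<close>.
\<close>

lemma regular_mode_raise:
  assumes "regular_mode k \<mu> y z"
  shows "regular_mode (Suc k) \<mu> (\<lambda>t. cosh t * (z t + k * tanh t * y t))
    (\<lambda>t. (real k + 1) * sinh t * (z t + k * tanh t * y t) + (real k * (real k + 1) - \<mu>) / cosh t * y t)"
proof -
  define w where "w = (\<lambda>t. z t + k * tanh t * y t)"
  define c where "c = real k * (real k + 1) - \<mu>"
  obtain B where B: "\<forall>\<^sub>F t in at_top. \<bar>w t\<bar> \<le> B / (cosh t)\<^sup>2"
    using raised_decay[OF assms] unfolding w_def .
  have [continuous_intros]: "continuous_on {0..} w"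
    unfolding w_def using assms
    by (auto simp: regular_mode_def intro!: continuous_intros continuous_on_tanh_real)
  have cont: "continuous_on {0..} (\<lambda>t. cosh t * w t)"
    "continuous_on {0..} (\<lambda>t. (real k + 1) * sinh t * w t + c / cosh t * y t)"
    using assms by (auto simp: regular_mode_def intro!: continuous_intros)
  have w': "(w has_real_derivative k * tanh t * w t + c / (cosh t)\<^sup>2 * y t) (at t)"
    if "0 < t" for t
    unfolding w_def c_def using assms that
    by (intro has_derivative_raised) (auto simp: regular_mode_def)
  have y': "((\<lambda>t. cosh t * w t) has_real_derivative ((real k + 1) * sinh t * w t + c / cosh t * y t)) (at t)"
    if "0 < t" for t
    by (auto intro!: derivative_eq_intros w'[OF that] simp: tanh_def field_simps power2_eq_square)
  have z': "((\<lambda>t. (real k + 1) * sinh t * w t + c / cosh t * y t) has_real_derivative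
      ((real (Suc k))\<^sup>2 - \<mu> / (cosh t)\<^sup>2) * (cosh t * w t)) (at t)"
    if t: "0 < t" for t
  proof -
    have [derivative_intros]: "(y has_real_derivative (w t - k * tanh t * y t)) (at t)"
      using assms t by (auto simp: regular_mode_def w_def)
    have "((\<lambda>t. (real k + 1) * sinh t * w t + c / cosh t * y t) has_real_derivative
       (real k + 1) * cosh t * w t + (real k + 1) * sinh t * (k * tanh t * w t + c / (cosh t)\<^sup>2 * y t)
        + (- c * sinh t / (cosh t)\<^sup>2 * y t + c / cosh t * (w t - k * tanh t * y t))) (at t)"
      by (auto intro!: derivative_eq_intros w'[OF t] simp: power2_eq_square field_simps)
    also have "(real k + 1) * cosh t * w t + (real k + 1) * sinh t * (k * tanh t * w t + c / (cosh t)\<^sup>2 * y t)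
        + (- c * sinh t / (cosh t)\<^sup>2 * y t + c / cosh t * (w t - k * tanh t * y t))
       = ((real k + 1) * (cosh t)\<^sup>2 + (real k + 1) * real k * (sinh t)\<^sup>2 + c) * w t / cosh t"
      by (simp add: tanh_def field_simps power2_eq_square)
    also have "(sinh t)\<^sup>2 = (cosh t)\<^sup>2 - 1" by (simp add: cosh_square_eq)
    also have "((real k + 1) * (cosh t)\<^sup>2 + (real k + 1) * real k * ((cosh t)\<^sup>2 - 1) + c) * w t / cosh t
       = ((real (Suc k))\<^sup>2 - \<mu> / (cosh t)\<^sup>2) * (cosh t * w t)"
      by (simp add: c_def field_simps power2_eq_square)
    finally show ?thesis .
  qed
  have inv0: "((\<lambda>t. B' * inverse (cosh t)) \<longlongrightarrow> 0) at_top" for B' :: real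
    by (intro tendsto_mult_right_zero tendsto_inverse_0_at_top cosh_real_at_top)
  have lim: "((\<lambda>t. cosh t * w t) \<longlongrightarrow> 0) at_top"
  proof (rule tendsto_rabs_zero_cancel, rule tendsto_sandwich[OF _ _ tendsto_const inv0])
    show "\<forall>\<^sub>F t in at_top. \<bar>cosh t * w t\<bar> \<le> B * inverse (cosh t)"
      using B by eventually_elim (simp add: abs_mult field_simps power2_eq_square)
  qed simp
  obtain L where L: "(y \<longlongrightarrow> L) at_top"
    using assms by (auto simp: regular_mode_def)
  have limz: "((\<lambda>t. (real k + 1) * sinh t * w t + c / cosh t * y t) \<longlongrightarrow> 0) at_top"
  proof -
    have "((\<lambda>t. (real k + 1) * tanh t * (cosh t * w t) + c * inverse (cosh t) * y t) 
        \<longlongrightarrow> (real k + 1) * 1 * 0 + 0 * L) at_top"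
      by (intro tendsto_intros lim L inv0 tanh_real_at_top)
    then show ?thesis by (simp add: tanh_def field_simps)
  qed
  have "regular_mode (Suc k) \<mu> (\<lambda>t. cosh t * w t)
      (\<lambda>t. (real k + 1) * sinh t * w t + c / cosh t * y t)"
    unfolding regular_mode_def using cont y' z' lim limz by auto
  then show ?thesis by (simp only: w_def c_def)
qed

text \<open>
  The Wronskian \<open>y1 z2 - z1 y2\<close> is constant and tends to \<open>0\<close>: for \<open>k = 0\<close> the modes themselves may have
  nonzero limits, but they are bounded and their derivatives decay.
\<close>

lemma regular_mode_wronskian:
  assumes "regular_mode k \<mu> y1 z1" "regular_mode k \<mu> y2 z2"
  shows "y1 0 * z2 0 = z1 0 * y2 0"
proof -
  define W where "W = (\<lambda>t. y1 t * z2 t - z1 t * y2 t)"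
  obtain L1 L2 where L: "(y1 \<longlongrightarrow> L1) at_top" "(y2 \<longlongrightarrow> L2) at_top"
    "(z1 \<longlongrightarrow> 0) at_top" "(z2 \<longlongrightarrow> 0) at_top"
    using assms by (auto simp: regular_mode_def)
  have le: "e * W 0 \<le> e * (L1 * 0 - 0 * L2)" for e
  proof (rule nonneg_derivative_imp_le_limit[where h = "\<lambda>t. e * W t" and h' = "\<lambda>_. 0" and a = 0])
    show "continuous_on {0..} (\<lambda>t. e * W t)"
      using assms unfolding W_def by (auto simp: regular_mode_def intro!: continuous_intros)
    show "((\<lambda>t. e * W t) has_real_derivative 0) (at t)" if "0 < t" for t
      using assms that unfolding W_def regular_mode_def
      by (auto intro!: derivative_eq_intros simp: algebra_simps)
    show "((\<lambda>t. e * W t) \<longlongrightarrow> e * (L1 * 0 - 0 * L2)) at_top"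
      unfolding W_def by (intro tendsto_intros L)
  qed simp
  show ?thesis using le[of 1] le[of "-1"] by (simp add: W_def)
qed

section \<open>Slopes at the equator and separation of sectors\<close>

text \<open>
  If \<open>\<mu> \<le> k (k + 1)\<close>, then \<open>y w\<close> with \<open>w = y' + k tanh t y\<close> has the derivative
  \<open>w\<^sup>2 + (k (k + 1) - \<mu>) y\<^sup>2 / cosh\<^sup>2 t \<ge> 0\<close>, so it
  cannot pass from the positive value \<open>y(0) y'(0)\<close> to its limit \<open>0\<close>.
\<close>

lemma regular_mode_eigenvalue_bound:
  assumes "regular_mode k \<mu> y z" and "0 < y 0 * z 0"
  shows "real k * (real k + 1) < \<mu>"
proof (rule ccontr)
  assume "\<not> ?thesis"
  then have c: "0 \<le> real k * (real k + 1) - \<mu>" by simp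
  define w where "w = (\<lambda>t. z t + k * tanh t * y t)"
  obtain L where L: "(y \<longlongrightarrow> L) at_top" "real k * L = 0" and z: "(z \<longlongrightarrow> 0) at_top"
    using assms by (auto simp: regular_mode_def)
  have "y 0 * w 0 \<le> L * (0 + real k * 1 * L)"
  proof (rule nonneg_derivative_imp_le_limit[where h = "\<lambda>t. y t * w t" and a = 0])
    show "continuous_on {0..} (\<lambda>t. y t * w t)"
      unfolding w_def using assms
      by (auto simp: regular_mode_def intro!: continuous_intros continuous_on_tanh_real)
    show "((\<lambda>t. y t * w t) \<longlongrightarrow> L * (0 + real k * 1 * L)) at_top"
      unfolding w_def by (intro tendsto_intros z L tanh_real_at_top)
    fix t :: real assume t: "0 < t"
    have [derivative_intros]: "(y has_real_derivative (w t - k * tanh t * y t)) (at t)"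
      using assms t by (auto simp: regular_mode_def w_def)
    have [derivative_intros]: "(w has_real_derivative
        k * tanh t * w t + (real k * (real k + 1) - \<mu>) / (cosh t)\<^sup>2 * y t) (at t)"
      unfolding w_def using assms t
      by (intro has_derivative_raised) (auto simp: regular_mode_def)
    show "((\<lambda>t. y t * w t) has_real_derivative
       (w t)\<^sup>2 + (real k * (real k + 1) - \<mu>) / (cosh t)\<^sup>2 * (y t)\<^sup>2) (at t)"
      by (auto intro!: derivative_eq_intros simp: algebra_simps power2_eq_square)
    show "0 \<le> (w t)\<^sup>2 + (real k * (real k + 1) - \<mu>) / (cosh t)\<^sup>2 * (y t)\<^sup>2"
      using c by (intro add_nonneg_nonneg mult_nonneg_nonneg divide_nonneg_nonneg) auto
  qed
  then show False using assms(2) L(2) by (simp add: w_def mult.assoc[symmetric])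
qed

text \<open>
  The invariant of the repeated raising.  In the second alternative, reached after an odd number of
  steps, the bound on \<open>- r \<sigma>\<close> is the constant \<open>c\<^bsub>k+n-1\<^esub> = \<mu> - (k + n - 1) (k + n)\<close> of the preceding step; since the
  next constant is strictly smaller, the next slope is strictly below \<open>\<sigma>\<close>.
\<close>

lemma raised_mode_slope:
  assumes "regular_mode k \<mu> y z" "y 0 \<noteq> 0" "z 0 = \<sigma> * y 0" "0 < \<sigma>"
    and "\<And>j. j < k + n \<Longrightarrow> real j * (real j + 1) < \<mu>"
  shows "\<exists>y z r. regular_mode (k + n) \<mu> y z \<and> y 0 \<noteq> 0 \<and> z 0 = r * y 0 \<and>
     (0 < r \<and> r \<le> \<sigma> \<and> (0 < n \<longrightarrow> r < \<sigma>) \<or>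
      r < 0 \<and> 0 < n \<and> \<mu> - (real (k + n) - 1) * real (k + n) \<le> - r * \<sigma>)"
  using assms(5)
proof (induction n)
  case 0
  then show ?case using assms by auto
next
  case (Suc n)
  have "\<And>j. j < k + n \<Longrightarrow> real j * (real j + 1) < \<mu>" using Suc.prems by simp
  from Suc.IH[OF this] obtain y z r where reg: "regular_mode (k + n) \<mu> y z"
    and y0: "y 0 \<noteq> 0" and z0: "z 0 = r * y 0"
    and r: "0 < r \<and> r \<le> \<sigma> \<or>
      r < 0 \<and> 0 < n \<and> \<mu> - (real (k + n) - 1) * real (k + n) \<le> - r * \<sigma>"
    by blast
  define c where "c = \<mu> - real (k + n) * (real (k + n) + 1)"
  have c: "0 < c" using Suc.prems[of "k + n"] by (simp add: c_def)
  have r0: "r \<noteq> 0" using r by auto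
  let ?y = "\<lambda>t. cosh t * (z t + real (k + n) * tanh t * y t)"
  let ?z = "\<lambda>t. (real (k + n) + 1) * sinh t * (z t + real (k + n) * tanh t * y t)
      + (real (k + n) * (real (k + n) + 1) - \<mu>) / cosh t * y t"
  have "regular_mode (k + Suc n) \<mu> ?y ?z"
    using regular_mode_raise[OF reg] by (simp add: add.commute)
  moreover have "?y 0 \<noteq> 0" using z0 r0 y0 by simp
  moreover have "?z 0 = (- c / r) * ?y 0" using z0 r0 by (simp add: c_def)
  moreover have "0 < - c / r \<and> - c / r \<le> \<sigma> \<and> (0 < Suc n \<longrightarrow> - c / r < \<sigma>) \<or>
      - c / r < 0 \<and> 0 < Suc n \<and> \<mu> - (real (k + Suc n) - 1) * real (k + Suc n) \<le> - (- c / r) * \<sigma>"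
    using r
  proof
    assume r: "0 < r \<and> r \<le> \<sigma>"
    then have "c * r \<le> c * \<sigma>" using c by simp
    then have "c \<le> - (- c / r) * \<sigma>" using r by (simp add: field_simps)
    moreover have "\<mu> - (real (k + Suc n) - 1) * real (k + Suc n) = c"
      by (simp add: c_def algebra_simps)
    ultimately show ?thesis using r c by simp
  next
    assume r: "r < 0 \<and> 0 < n \<and> \<mu> - (real (k + n) - 1) * real (k + n) \<le> - r * \<sigma>"
    then have "c < \<mu> - (real (k + n) - 1) * real (k + n)"
      by (simp add: c_def algebra_simps)
    also have "\<dots> \<le> - r * \<sigma>" using r by simp
    finally have "- c / r < \<sigma>" using r by (simp add: field_simps)
    moreover have "0 < - c / r" using r c by (simp add: field_simps)
    ultimately show ?thesis by simp
  qed
  ultimately show ?case by blast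
qed

lemma robin_modes_disjoint:
  assumes "0 < \<sigma>" "k < k'"
    and "regular_mode k \<mu> y z" "z 0 = \<sigma> * y 0" "0 \<le> t" "y t \<noteq> 0"
    and "regular_mode k' \<mu> y' z'" "z' 0 = \<sigma> * y' 0" "0 \<le> t'" "y' t' \<noteq> 0"
  shows False
proof -
  have y0: "y 0 \<noteq> 0"
    using regular_mode_zero_data[OF assms(3)] assms(4-6) by force
  have y'0: "y' 0 \<noteq> 0"
    using regular_mode_zero_data[OF assms(7)] assms(8-10) by force
  have "0 < y' 0 * z' 0"
    using assms(1,8) y'0 by (simp add: mult.left_commute[of "y' 0"] zero_less_mult_iff) linarith
  then have bound: "real k' * (real k' + 1) < \<mu>"
    by (rule regular_mode_eigenvalue_bound[OF assms(7)])
  define n where "n = k' - k"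
  have n: "k + n = k'" "0 < n" using assms(2) by (auto simp: n_def)
  have "real j * (real j + 1) < \<mu>" if "j < k + n" for j
  proof -
    have "real j * (real j + 1) \<le> real k' * (real k' + 1)"
      using that n by (intro mult_mono) auto
    then show ?thesis using bound by simp
  qed
  from raised_mode_slope[OF assms(3) y0 assms(4,1) this] n
  obtain u v r where u: "regular_mode k' \<mu> u v" "u 0 \<noteq> 0" "v 0 = r * u 0"
    and r: "r < \<sigma> \<or> r < 0" by metis
  have "u 0 * z' 0 = v 0 * y' 0"
    by (rule regular_mode_wronskian[OF u(1) assms(7)])
  then have "r = \<sigma>" using u y'0 assms(8) by simp
  then show False using r assms(1) by auto
qed

section \<open>One-sided derivative at the equator\<close>

text \<open>
  The boundary condition only provides a one-sided derivative of the eigenfunction, whereas the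
  Wronskian argument needs the derivative to be continuous up to the equator.  The equation itself
  gives this: \<open>z' = p\<close> with \<open>p\<close> continuous up to \<open>0\<close>, so \<open>z\<close> has a limit there, and by l'Hospital's rule the
  limit is the one-sided derivative of \<open>y\<close>.
\<close>

lemma derivative_continuous_at_endpoint:
  fixes y z p :: "real \<Rightarrow> real"
  assumes y: "continuous_on {0..} y" and p: "continuous_on {0..} p"
    and y': "\<And>t. 0 < t \<Longrightarrow> (y has_real_derivative z t) (at t)"
    and z': "\<And>t. 0 < t \<Longrightarrow> (z has_real_derivative p t) (at t)"
    and d: "(y has_real_derivative d) (at 0 within {0..})"
  shows "(z \<longlongrightarrow> d) (at_right 0)"
proof -
  define Q where "Q = (\<lambda>t. integral {0..t} p)"
  have p1: "continuous_on {0..1} p" using p by (rule continuous_on_subset) auto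
  have Q: "(Q has_real_derivative p t) (at t within {0..1})" if "t \<in> {0..1}" for t
    unfolding Q_def using p1 that by (rule integral_has_real_derivative)
  have "\<exists>C. \<forall>t\<in>{0<..<1}. z t - Q t = C"
  proof (rule has_field_derivative_zero_constant[where f = "\<lambda>t. z t - Q t"])
    show "((\<lambda>t. z t - Q t) has_real_derivative 0) (at t within {0<..<1})" if "t \<in> {0<..<1}" for t
    proof -
      have "(Q has_real_derivative p t) (at t within {0<..<1})"
        by (rule DERIV_subset[OF Q]) (use that in auto)
      moreover have "(z has_real_derivative p t) (at t within {0<..<1})"
        using z' that by (auto intro: has_field_derivative_at_within)
      ultimately show ?thesis by (auto intro!: derivative_eq_intros)
    qed
  qed auto
  then obtain C where C: "\<And>t. 0 < t \<Longrightarrow> t < 1 \<Longrightarrow> z t = C + Q t" by (auto simp: algebra_simps)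
  have near: "\<forall>\<^sub>F t in at_right 0. t \<in> {0<..<(1::real)}"
    by (rule eventually_at_right_real) simp
  have "(Q \<longlongrightarrow> Q 0) (at 0 within {0..1})"
    using DERIV_continuous[OF Q[of 0]] by (simp add: continuous_within)
  moreover have "at 0 within {0..1} = at_right (0::real)"
    by (simp add: at_within_Icc_at_right)
  ultimately have "(Q \<longlongrightarrow> Q 0) (at_right 0)" by simp
  then have "((\<lambda>t. C + Q t) \<longlongrightarrow> C + Q 0) (at_right 0)"
    by (intro tendsto_intros)
  then have z: "(z \<longlongrightarrow> C + Q 0) (at_right 0)"
    by (rule Lim_transform_eventually) (use near C in \<open>auto elim!: eventually_mono\<close>)
  have "((\<lambda>t. (y t - y 0) / t) \<longlongrightarrow> C + Q 0) (at_right 0)"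
  proof (rule lhopital_right_0)
    have "(y \<longlongrightarrow> y 0) (at_right 0)"
      using y by (auto simp: continuous_on_def intro: tendsto_within_subset)
    then show "((\<lambda>t. y t - y 0) \<longlongrightarrow> 0) (at_right 0)"
      by (simp add: LIM_zero)
    show "((\<lambda>t. t) \<longlongrightarrow> 0) (at_right (0::real))" by (rule tendsto_ident_at)
    show "\<forall>\<^sub>F t in at_right 0. ((\<lambda>t. y t - y 0) has_real_derivative z t) (at t)"
      using near by eventually_elim (auto intro!: derivative_eq_intros y')
    show "((\<lambda>t. z t / 1) \<longlongrightarrow> C + Q 0) (at_right 0)" using z by simp
  qed (use near in \<open>auto elim!: eventually_mono intro!: derivative_eq_intros\<close>)
  moreover have "((\<lambda>t. (y t - y 0) / t) \<longlongrightarrow> d) (at_right 0)"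
    using d unfolding has_field_derivative_iff
    by (auto intro: tendsto_within_subset)
  ultimately have "d = C + Q 0"
    by (intro tendsto_unique[of "at_right 0" "\<lambda>t. (y t - y 0) / t"]) auto
  then show ?thesis using z by simp
qed

section \<open>Coordinates in space\<close>

lemma norm_vector3: "norm (vector [a, b, c] :: real^3) = sqrt (a\<^sup>2 + b\<^sup>2 + c\<^sup>2)"
  by (simp add: norm_eq_sqrt_inner inner_vec_def sum_3 power2_eq_square)

lemma scaleR_vector3: "r *\<^sub>R (vector [a, b, c] :: real^3) = vector [r * a, r * b, r * c]"
  by (simp add: vec_eq_iff forall_3)

lemma add_vector3: "(vector [a, b, c] :: real^3) + vector [a', b', c'] = vector [a + a', b + b', c + c']"
  by (simp add: vec_eq_iff forall_3)

lemma diff_vector3: "(vector [a, b, c] :: real^3) - vector [a', b', c'] = vector [a - a', b - b', c - c']"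
  by (simp add: vec_eq_iff forall_3)

lemma axis_vector3:
  "axis 1 1 = (vector [1, 0, 0] :: real^3)" "axis 2 1 = (vector [0, 1, 0] :: real^3)"
  "axis 3 1 = (vector [0, 0, 1] :: real^3)"
  by (simp_all add: vec_eq_iff forall_3 axis_def)

lemma Basis_real3: "(Basis :: (real^3) set) = {axis 1 1, axis 2 1, axis 3 1}"
  by (auto simp: Basis_vec_def UNIV_3)

lemma sgn_vector3_scale: "0 < r \<Longrightarrow> sgn (vector [r * a, r * b, r * c] :: real^3) = sgn (vector [a, b, c])"
  by (simp add: scaleR_vector3[symmetric] sgn_scaleR)

lemma sgn_vector3_unit: "a\<^sup>2 + b\<^sup>2 + c\<^sup>2 = 1 \<Longrightarrow> sgn (vector [a, b, c] :: real^3) = vector [a, b, c]"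
  by (simp add: sgn_div_norm norm_vector3)

lemma laplacian_real3:
  fixes G :: "real^3 \<Rightarrow> complex"
  shows "laplacian G x = partial_deriv (axis 1 1) (partial_deriv (axis 1 1) G) x
    + partial_deriv (axis 2 1) (partial_deriv (axis 2 1) G) x
    + partial_deriv (axis 3 1) (partial_deriv (axis 3 1) G) x"
  unfolding laplacian_def Basis_real3 by (simp add: axis_eq_axis)

lemma differentiable_on_line_derivative:
  assumes "H differentiable_on S" "open S" "x + t *\<^sub>R b \<in> S"
  shows "((\<lambda>t. H (x + t *\<^sub>R b)) has_vector_derivative partial_deriv b H (x + t *\<^sub>R b)) (at t)"
proof -
  let ?D = "frechet_derivative H (at (x + t *\<^sub>R b))"
  have "H differentiable at (x + t *\<^sub>R b)"
    using assms by (simp add: differentiable_on_eq_differentiable_at)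
  then have D: "(H has_derivative ?D) (at (x + t *\<^sub>R b))"
    by (simp add: frechet_derivative_works)
  have line: "((\<lambda>t. x + t *\<^sub>R b) has_derivative (\<lambda>h. h *\<^sub>R b)) (at t)"
    by (auto intro!: derivative_eq_intros)
  have "((\<lambda>t. H (x + t *\<^sub>R b)) has_derivative (\<lambda>h. ?D (h *\<^sub>R b))) (at t)"
    using diff_chain_at[OF line D] by (simp add: o_def)
  moreover have "?D (h *\<^sub>R b) = h *\<^sub>R ?D b" for h
    using has_derivative_linear[OF D] by (simp add: linear_cmul)
  ultimately show ?thesis by (simp add: has_vector_derivative_def partial_deriv_def)
qed

text \<open>
  Second partial derivatives are computed from explicit formulas along coordinate lines, so
  that only one-dimensional chain rules occur.
\<close>

lemma second_partial_eq:
  assumes C2: "C2_on S G" and S: "open S" and b: "b \<in> Basis" and x: "x \<in> S"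
    and T: "open T" "0 \<in> T" and eq: "\<And>t. t \<in> T \<Longrightarrow> G (x + t *\<^sub>R b) = p t"
    and p: "\<And>t. t \<in> T \<Longrightarrow> (p has_vector_derivative p1 t) (at t)"
    and p1: "(p1 has_vector_derivative p2) (at 0)"
  shows "partial_deriv b (partial_deriv b G) x = p2"
proof -
  define U where "U = T \<inter> (\<lambda>t. x + t *\<^sub>R b) -` S"
  have U: "open U" "0 \<in> U"
    unfolding U_def using T S x
    by (auto intro!: open_Int open_vimage continuous_intros)
  have diff: "G differentiable_on S" "partial_deriv b G differentiable_on S"
    using C2 b by (auto simp: C2_on_def)
  have "partial_deriv b G (x + t *\<^sub>R b) = p1 t" if t: "t \<in> U" for t
  proof (rule vector_derivative_unique_at)
    show "(p has_vector_derivative p1 t) (at t)" using p t by (simp add: U_def)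
    show "(p has_vector_derivative partial_deriv b G (x + t *\<^sub>R b)) (at t)"
    proof (rule has_vector_derivative_transform_within_open)
      show "((\<lambda>t. G (x + t *\<^sub>R b)) has_vector_derivative partial_deriv b G (x + t *\<^sub>R b)) (at t)"
        using t by (intro differentiable_on_line_derivative[OF diff(1) S]) (auto simp: U_def)
    qed (use U t eq in \<open>auto simp: U_def\<close>)
  qed
  then have "(p1 has_vector_derivative partial_deriv b (partial_deriv b G) (x + 0 *\<^sub>R b)) (at 0)"
    using x U
    by (intro has_vector_derivative_transform_within_open[OF
          differentiable_on_line_derivative[OF diff(2) S], of x 0 b U]) auto
  from vector_derivative_unique_at[OF this p1] show ?thesis by simp
qed

lemma has_vector_derivative_compose_real:
  fixes \<psi> :: "real \<Rightarrow> real"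
  assumes "(\<psi> has_real_derivative d) (at t)" "(g has_vector_derivative g') (at (\<psi> t))"
  shows "((\<lambda>t. g (\<psi> t)) has_vector_derivative d *\<^sub>R g') (at t)"
  using vector_diff_chain_at[OF assms(1)[unfolded has_real_derivative_iff_has_vector_derivative] assms(2)]
  by (simp add: o_def)

section \<open>Functions in a sector\<close>

text \<open>
  A function in sector \<open>k\<close> is determined by its values on one meridian.  The azimuth is written as
  \<open>arctan (h / s)\<close>, which is smooth across the plane \<open>h = 0\<close>, where the azimuth in \<open>{0..<2*pi}\<close> jumps; the factor
  \<open>exp (\<i> k \<phi>)\<close> does not see the jump.
\<close>

lemma in_sector_meridian:
  assumes F: "in_sector k F" and s: "0 < s" and c: "0 \<le> c"
  shows "F (sgn (vector [s, h, c])) = exp (\<i> * of_int k * of_real (arctan (h / s)))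
     * F (sgn (vector [1, 0, c / sqrt (s\<^sup>2 + h\<^sup>2)]))"
proof -
  obtain f where f: "\<And>\<theta> \<phi>. \<theta> \<in> {0..pi/2} \<Longrightarrow> \<phi> \<in> {0..<2*pi} \<Longrightarrow>
      F (sph \<theta> \<phi>) = exp (\<i> * of_int k * of_real \<phi>) * f (cos \<theta>)"
    using F by (auto simp: in_sector_def)
  define \<rho> where "\<rho> = sqrt (s\<^sup>2 + h\<^sup>2)"
  define R where "R = sqrt (\<rho>\<^sup>2 + c\<^sup>2)"
  define \<alpha> where "\<alpha> = arctan (h / s)"
  define \<theta> where "\<theta> = arccos (c / R)"
  define \<phi> where "\<phi> = (if 0 \<le> \<alpha> then \<alpha> else \<alpha> + 2 * pi)"
  have \<rho>: "0 < \<rho>" "\<rho>\<^sup>2 = s\<^sup>2 + h\<^sup>2" using s by (auto simp: \<rho>_def add_pos_nonneg)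
  have R: "0 < R" "R\<^sup>2 = \<rho>\<^sup>2 + c\<^sup>2" using \<rho>(1) by (auto simp: R_def intro!: add_pos_nonneg)
  have "c \<le> R"
    by (rule power2_le_imp_le) (use R in simp_all)
  then have cR: "0 \<le> c / R" "c / R \<le> 1"
    using c R(1) by simp_all
  have "0 \<le> \<theta>" "\<theta> \<le> pi / 2"
    unfolding \<theta>_def using cR arccos_le_pi2[OF cR] arccos_lbound[of "c / R"] by auto
  then have \<theta>: "\<theta> \<in> {0..pi/2}" "cos \<theta> = c / R"
    using cR by (auto simp: \<theta>_def)
  have "(\<rho> / R)\<^sup>2 + (c / R)\<^sup>2 = 1"
    using R(1) by (simp add: power_divide add_divide_distrib[symmetric] R(2)[symmetric])
  then have "(sin \<theta>)\<^sup>2 = (\<rho> / R)\<^sup>2"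
    by (simp add: sin_squared_eq \<theta>(2))
  moreover have "0 \<le> sin \<theta>" using \<theta>(1) by (auto intro!: sin_ge_zero)
  ultimately have sin: "sin \<theta> = \<rho> / R" using R(1) \<rho>(1) by (simp add: power2_eq_iff_nonneg)
  have "sqrt (1 + (h / s)\<^sup>2) = \<rho> / s"
  proof (rule real_sqrt_unique)
    show "(\<rho> / s)\<^sup>2 = 1 + (h / s)\<^sup>2" using s by (simp add: \<rho>(2) power_divide field_simps)
  qed (use s \<rho> in auto)
  then have \<alpha>: "cos \<alpha> = s / \<rho>" "sin \<alpha> = h / \<rho>"
    using s by (simp_all add: \<alpha>_def cos_arctan sin_arctan)
  have \<phi>: "\<phi> \<in> {0..<2*pi}" "cos \<phi> = s / \<rho>" "sin \<phi> = h / \<rho>"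
    using \<alpha> arctan_bounded[of "h / s"] by (auto simp: \<phi>_def \<alpha>_def[symmetric])
  have e: "exp (\<i> * of_int k * of_real \<phi>) = exp (\<i> * of_int k * of_real \<alpha>)"
    using exp_plus_2pin[of "\<i> * of_int k * of_real \<alpha>" k]
    by (auto simp: \<phi>_def algebra_simps)
  have "norm (vector [s, h, c] :: real^3) = R" "norm (vector [\<rho>, 0, c] :: real^3) = R"
    by (simp_all add: norm_vector3 R_def \<rho>(2))
  then have "sgn (vector [s, h, c]) = sph \<theta> \<phi>" "sgn (vector [\<rho>, 0, c]) = sph \<theta> 0"
    using \<rho>(1) R(1) by (simp_all add: sgn_div_norm scaleR_vector3 sph_def \<phi> \<theta> sin inverse_eq_divide)
  moreover have "sgn (vector [\<rho> * 1, \<rho> * 0, \<rho> * (c / \<rho>)] :: real^3) = sgn (vector [1, 0, c / \<rho>])"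
    using \<rho>(1) by (rule sgn_vector3_scale)
  then have "sgn (vector [\<rho>, 0, c] :: real^3) = sgn (vector [1, 0, c / \<rho>])"
    using \<rho>(1) by simp
  ultimately show ?thesis
    using f[OF \<theta>(1) \<phi>(1)] f[OF \<theta>(1), of 0] e by (simp add: \<rho>_def[symmetric] \<alpha>_def[symmetric])
qed

text \<open>
  At the pole all azimuths describe the same point, and the azimuth \<open>pi / \<bar>k\<bar>\<close> makes the angular factor \<open>-1\<close>.
\<close>

lemma in_sector_pole:
  assumes "in_sector k F" "k \<noteq> 0"
  shows "F (vector [0, 0, 1]) = 0"
proof -
  obtain f where f: "\<And>\<theta> \<phi>. \<theta> \<in> {0..pi/2} \<Longrightarrow> \<phi> \<in> {0..<2*pi} \<Longrightarrow>
      F (sph \<theta> \<phi>) = exp (\<i> * of_int k * of_real \<phi>) * f (cos \<theta>)"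
    using assms by (auto simp: in_sector_def)
  have pole: "sph 0 \<phi> = vector [0, 0, 1]" for \<phi> by (simp add: sph_def)
  define \<phi> where "\<phi> = pi / \<bar>of_int k\<bar>"
  have "1 \<le> \<bar>real_of_int k\<bar>" using assms(2) by (metis of_int_1_le_iff of_int_abs zero_less_abs_iff int_one_le_iff_zero_less)
  then have "pi / \<bar>real_of_int k\<bar> \<le> pi / 1" by (intro divide_left_mono) auto
  then have "\<phi> \<le> pi" by (simp add: \<phi>_def)
  moreover have "0 \<le> \<phi>" by (simp add: \<phi>_def)
  moreover have "\<phi> < 2 * pi" using \<open>\<phi> \<le> pi\<close> pi_gt_zero by linarith
  ultimately have \<phi>: "\<phi> \<in> {0..<2*pi}" by simp
  have "of_int k * \<phi> = pi \<or> of_int k * \<phi> = - pi"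
    using assms(2) by (auto simp: \<phi>_def abs_if)
  then have "of_int k * of_real \<phi> = (of_real pi :: complex) \<or> of_int k * of_real \<phi> = (- of_real pi :: complex)"
    by (metis of_real_minus of_real_mult of_real_of_int_eq)
  then have "exp (\<i> * of_int k * of_real \<phi>) = -1"
    by (auto simp: mult.assoc exp_minus)
  then have "F (vector [0, 0, 1]) = - F (vector [0, 0, 1])"
    using f[of 0 0] f[of 0 \<phi>] \<phi> by (simp add: pole)
  then show ?thesis by simp
qed

text \<open>
  The pole is a separate case because it is not reached at any finite \<open>t\<close>.
\<close>

lemma in_sector_nonzero:
  assumes F: "in_sector k F" and x: "x \<in> hemisphere" "F x \<noteq> 0"
  shows "F (vector [0, 0, 1]) \<noteq> 0 \<or> (\<exists>t\<ge>0. F (sgn (vector [1, 0, sinh t])) \<noteq> 0)"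
proof -
  obtain f where f: "\<And>\<theta> \<phi>. \<theta> \<in> {0..pi/2} \<Longrightarrow> \<phi> \<in> {0..<2*pi} \<Longrightarrow>
      F (sph \<theta> \<phi>) = exp (\<i> * of_int k * of_real \<phi>) * f (cos \<theta>)"
    using F by (auto simp: in_sector_def)
  obtain a b c where abc: "x = vector [a, b, c]"
  proof
    show "x = vector [x $ 1, x $ 2, x $ 3]" by (simp add: vec_eq_iff forall_3)
  qed
  have n: "a\<^sup>2 + b\<^sup>2 + c\<^sup>2 = 1" "0 \<le> c"
    using x by (auto simp: hemisphere_def abc norm_vector3)
  show ?thesis
  proof (cases "a\<^sup>2 + b\<^sup>2 = 0")
    case True
    then have "c = 1" "a = 0" "b = 0" using n by (auto simp: power2_eq_1_iff)
    then show ?thesis using x abc by simp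
  next
    case False
    define r where "r = sqrt (a\<^sup>2 + b\<^sup>2)"
    have r: "0 < r" "r\<^sup>2 = a\<^sup>2 + b\<^sup>2" using False by (auto simp: r_def less_le)
    have "(a / r)\<^sup>2 + (b / r)\<^sup>2 = 1"
      using r False by (simp add: power_divide add_divide_distrib[symmetric])
    then obtain \<phi> where \<phi>: "0 \<le> \<phi>" "\<phi> < 2 * pi" "a / r = cos \<phi>" "b / r = sin \<phi>"
      by (rule sincos_total_2pi)
    have rc: "c\<^sup>2 + r\<^sup>2 = 1" using r(2) n(1) by simp
    obtain \<theta> where \<theta>: "0 \<le> \<theta>" "\<theta> \<le> pi/2" "c = cos \<theta>" "r = sin \<theta>"
      using sincos_total_pi_half[OF n(2) _ rc] r(1) by (metis less_imp_le)
    have "a = r * cos \<phi>" "b = r * sin \<phi>"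
      using r(1) by (simp_all flip: \<phi>(3,4))
    then have "x = sph \<theta> \<phi>" by (simp add: abc sph_def \<theta>(3,4))
    then have "f c \<noteq> 0" using f[of \<theta> \<phi>] \<theta> \<phi> x by auto
    then have "F (sph \<theta> 0) \<noteq> 0" using f[of \<theta> 0] \<theta> by auto
    moreover have "sph \<theta> 0 = sgn (vector [1, 0, sinh (arsinh (c / r))])"
    proof -
      have "sgn (vector [1, 0, c / r] :: real^3) = sgn (vector [r * 1, r * 0, r * (c / r)])"
        using r(1) by (rule sgn_vector3_scale[symmetric])
      also have "\<dots> = vector [r, 0, c]"
        using r(1) rc by (simp add: sgn_vector3_unit add.commute)
      finally show ?thesis by (simp add: sph_def \<theta>(3,4))
    qed
    moreover have "0 \<le> arsinh (c / r)"
    proof -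
      have "0 \<le> sinh (arsinh (c / r))" using r(1) n(2) by simp
      then show ?thesis by (simp only: sinh_real_nonneg_iff)
    qed
    ultimately show ?thesis by metis
  qed
qed

section \<open>The eigenvalue equation along a meridian\<close>

text \<open>
  Here \<open>g t\<close> is the value of \<open>F\<close> in the direction \<open>(1, 0, t)\<close>, so that \<open>t = cot \<theta>\<close>.  In this
  coordinate the extension along rays is \<open>g (z / x)\<close> on the plane \<open>y = 0\<close>, which makes the second derivatives in the
  first and third direction elementary; the second direction contributes the angular term
  \<open>- k\<^sup>2 / s\<^sup>2\<close> and a first-order term.
\<close>

lemma meridian_ode:
  fixes F :: "real^3 \<Rightarrow> complex" and g g1 g2 :: "real \<Rightarrow> complex"
  assumes F: "in_sector k F" and C2: "C2_on {y. 0 < y $ 3} (\<lambda>y. F (sgn y))"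
    and sc: "0 < s" "0 < c" "s\<^sup>2 + c\<^sup>2 = 1"
    and eig: "laplace_beltrami F (vector [s, 0, c]) + of_real \<mu> * F (vector [s, 0, c]) = 0"
    and g: "g = (\<lambda>t. F (sgn (vector [1, 0, t])))"
    and g1: "\<And>t. 0 < t \<Longrightarrow> (g has_vector_derivative g1 t) (at t)"
    and g2: "\<And>t. 0 < t \<Longrightarrow> (g1 has_vector_derivative g2 t) (at t)"
  shows "(1 / s\<^sup>2) *\<^sub>R g2 (c / s) + (c / s) *\<^sub>R g1 (c / s) = ((of_int k)\<^sup>2 - \<mu> * s\<^sup>2) *\<^sub>R g (c / s)"
proof -
  define G where "G = (\<lambda>y. F (sgn y))"
  define S where "S = {y :: real^3. 0 < y $ 3}"
  define x where "x = (vector [s, 0, c] :: real^3)"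
  have S: "open S" "x \<in> S"
    using sc by (auto simp: S_def x_def intro!: open_Collect_less continuous_intros)
  have C2: "C2_on S G" using C2 by (simp add: S_def G_def)
  have basis: "axis i 1 \<in> (Basis :: (real^3) set)" for i by (auto simp: Basis_vec_def)
  define u where "u = c / s"
  have u: "0 < u" using sc by (simp add: u_def)
  have merid: "F (sgn (vector [a, h, b])) = exp (\<i> * of_int k * of_real (arctan (h / a)))
      * g (b / sqrt (a\<^sup>2 + h\<^sup>2))" if "0 < a" "0 \<le> b" for a h b
    unfolding g using that by (rule in_sector_meridian[OF F])
  have merid0: "F (sgn (vector [a, 0, b])) = g (b / a)" if "0 < a" "0 \<le> b" for a b
    using merid[of a b 0] that by simp

  have d3: "partial_deriv (axis 3 1) (partial_deriv (axis 3 1) G) x = (1 / s\<^sup>2) *\<^sub>R g2 u"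
  proof (rule second_partial_eq[OF C2 S(1) basis S(2),
        where T = "{- c<..}" and p = "\<lambda>h. g ((c + h) / s)" and ?p1.0 = "\<lambda>h. (1 / s) *\<^sub>R g1 ((c + h) / s)"])
    show "G (x + h *\<^sub>R axis 3 1) = g ((c + h) / s)" if "h \<in> {- c<..}" for h
      using that sc merid0[of s "c + h"]
      by (simp add: G_def x_def axis_vector3 scaleR_vector3 add_vector3)
    show "((\<lambda>h. g ((c + h) / s)) has_vector_derivative (1 / s) *\<^sub>R g1 ((c + h) / s)) (at h)"
      if "h \<in> {- c<..}" for h
      using that sc by (intro has_vector_derivative_compose_real g1) (auto intro!: derivative_eq_intros)
    have "((\<lambda>h. g1 ((c + h) / s)) has_vector_derivative (1 / s) *\<^sub>R g2 u) (at 0)"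
      using sc u by (intro has_vector_derivative_compose_real)
        (auto intro!: derivative_eq_intros g2 simp: u_def)
    then have "((\<lambda>h. (1 / s) *\<^sub>R g1 ((c + h) / s)) has_vector_derivative (1 / s) *\<^sub>R (1 / s) *\<^sub>R g2 u) (at 0)"
      by (rule bounded_linear.has_vector_derivative[OF bounded_linear_scaleR_right])
    then show "((\<lambda>h. (1 / s) *\<^sub>R g1 ((c + h) / s)) has_vector_derivative (1 / s\<^sup>2) *\<^sub>R g2 u) (at 0)"
      by (simp add: power2_eq_square)
  qed (use sc in auto)

  have d1: "partial_deriv (axis 1 1) (partial_deriv (axis 1 1) G) x
      = (c / s\<^sup>2)\<^sup>2 *\<^sub>R g2 u + (2 * c / s ^ 3) *\<^sub>R g1 u"
  proof (rule second_partial_eq[OF C2 S(1) basis S(2), where T = "{- s<..}"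
        and p = "\<lambda>h. g (c / (s + h))" and ?p1.0 = "\<lambda>h. (- c / (s + h)\<^sup>2) *\<^sub>R g1 (c / (s + h))"])
    show "G (x + h *\<^sub>R axis 1 1) = g (c / (s + h))" if "h \<in> {- s<..}" for h
      using that sc merid0[of "s + h" c]
      by (simp add: G_def x_def axis_vector3 scaleR_vector3 add_vector3)
    have \<psi>: "((\<lambda>h. c / (s + h)) has_real_derivative (- c / (s + h)\<^sup>2)) (at h)"
      if "- s < h" for h
      using that by (auto intro!: derivative_eq_intros simp: power2_eq_square)
    show "((\<lambda>h. g (c / (s + h))) has_vector_derivative (- c / (s + h)\<^sup>2) *\<^sub>R g1 (c / (s + h))) (at h)"
      if "h \<in> {- s<..}" for h
      using that sc by (intro has_vector_derivative_compose_real g1 \<psi>) auto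
    have "((\<lambda>h. g1 (c / (s + h))) has_vector_derivative (- c / (s + 0)\<^sup>2) *\<^sub>R g2 u) (at 0)"
      using sc u by (intro has_vector_derivative_compose_real \<psi>)
        (auto intro!: g2 simp: u_def)
    moreover have "((\<lambda>h. - c / (s + h)\<^sup>2) has_real_derivative (2 * c / s ^ 3)) (at 0)"
      using sc by (auto intro!: derivative_eq_intros simp: power2_eq_square power3_eq_cube field_simps)
    ultimately have "((\<lambda>h. (- c / (s + h)\<^sup>2) *\<^sub>R g1 (c / (s + h))) has_vector_derivative
        (- c / (s + 0)\<^sup>2) *\<^sub>R (- c / (s + 0)\<^sup>2) *\<^sub>R g2 u + (2 * c / s ^ 3) *\<^sub>R g1 (c / (s + 0))) (at 0)"
      by (intro has_vector_derivative_scaleR)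
    then show "((\<lambda>h. (- c / (s + h)\<^sup>2) *\<^sub>R g1 (c / (s + h))) has_vector_derivative
        (c / s\<^sup>2)\<^sup>2 *\<^sub>R g2 u + (2 * c / s ^ 3) *\<^sub>R g1 u) (at 0)"
      by (simp add: u_def power2_eq_square)
  qed (use sc in auto)

  have d2: "partial_deriv (axis 2 1) (partial_deriv (axis 2 1) G) x
      = - (of_int k)\<^sup>2 / s\<^sup>2 * g u - (c / s ^ 3) *\<^sub>R g1 u"
  proof -
    define E where "E = (\<lambda>h. exp (\<i> * of_int k * of_real (arctan (h / s))))"
    define a where "a = (\<lambda>h. s / (s\<^sup>2 + h\<^sup>2))"
    define r where "r = (\<lambda>h. sqrt (s\<^sup>2 + h\<^sup>2))"
    have pos: "0 < s\<^sup>2 + h\<^sup>2" for h using sc by (simp add: add_pos_nonneg)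
    have rpos: "0 < r h" "r h \<noteq> 0" for h using sc(1) by (simp_all add: r_def add_pos_nonneg)
    have r': "(r has_real_derivative h / r h) (at h)" for h
    proof -
      have "((\<lambda>h. s\<^sup>2 + h\<^sup>2) has_real_derivative 2 * h) (at h)"
        by (auto intro!: derivative_eq_intros)
      then have "((\<lambda>h. sqrt (s\<^sup>2 + h\<^sup>2)) has_real_derivative
          (inverse (sqrt (s\<^sup>2 + h\<^sup>2)) / 2) * (2 * h)) (at h)"
        by (rule DERIV_chain2[where f = sqrt and g = "\<lambda>h. s\<^sup>2 + h\<^sup>2", OF DERIV_real_sqrt[OF pos]])
      moreover have "(inverse (sqrt (s\<^sup>2 + h\<^sup>2)) / 2) * (2 * h) = h / r h"
        by (simp add: r_def inverse_eq_divide)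
      ultimately show ?thesis by (simp only: r_def)
    qed
    have \<psi>: "((\<lambda>h. c / r h) has_real_derivative (- c * h / r h ^ 3)) (at h)" for h
      using rpos(2)[of h]
      by (auto intro!: derivative_eq_intros r' simp: power3_eq_cube)
    have atan: "((\<lambda>h. arctan (h / s)) has_real_derivative a h) (at h)" for h
    proof -
      have "((\<lambda>h. h / s) has_real_derivative 1 / s) (at h)"
        using sc(1) by (auto intro!: derivative_eq_intros)
      then have "((\<lambda>h. arctan (h / s)) has_real_derivative inverse (1 + (h / s)\<^sup>2) * (1 / s)) (at h)"
        by (rule DERIV_chain2[where f = arctan and g = "\<lambda>h. h / s", OF DERIV_arctan])
      moreover have "inverse (1 + (h / s)\<^sup>2) * (1 / s) = a h"
      proof -
        have "1 + (h / s)\<^sup>2 = (s\<^sup>2 + h\<^sup>2) / s\<^sup>2"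
          using sc(1) by (simp add: power_divide add_divide_distrib)
        then show ?thesis using sc(1) by (simp add: a_def power2_eq_square)
      qed
      ultimately show ?thesis by simp
    qed
    have E: "(E has_vector_derivative E h * (\<i> * of_int k * of_real (a h))) (at h)" for h
    proof -
      have "((\<lambda>h. \<i> * of_int k * of_real (arctan (h / s))) has_vector_derivative
          \<i> * of_int k * of_real (a h)) (at h)"
        by (intro has_vector_derivative_mult_right has_vector_derivative_of_real atan)
      from field_vector_diff_chain_at[OF this DERIV_exp] show ?thesis
        by (simp add: E_def o_def mult.commute)
    qed
    have a': "(a has_real_derivative 0) (at 0)"
      unfolding a_def using sc by (auto intro!: derivative_eq_intros)
    have b': "((\<lambda>h. - c * h / r h ^ 3) has_real_derivative - c / s ^ 3) (at 0)"
    proof -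
      have "((\<lambda>h. - c * h / r h ^ 3) has_real_derivative
          (- c * r 0 ^ 3 - (- c * 0) * (3 * r 0 ^ 2 * (0 / r 0))) / (r 0 ^ 3 * r 0 ^ 3)) (at 0)"
        using rpos(2)[of 0] by (auto intro!: derivative_eq_intros r')
      moreover have "(- c * r 0 ^ 3 - (- c * 0) * (3 * r 0 ^ 2 * (0 / r 0))) / (r 0 ^ 3 * r 0 ^ 3) = - c / s ^ 3"
        using sc(1) by (simp add: r_def eval_nat_numeral)
      ultimately show ?thesis by (simp only:)
    qed
    have ik: "\<i> * complex_of_int k * (\<i> * complex_of_int k) = - (of_int k * of_int k)"
      by (simp add: algebra_simps)
    have r0: "r 0 = s" using sc by (simp add: r_def)
    show ?thesis
    proof (rule second_partial_eq[OF C2 S(1) basis S(2), where T = UNIV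
        and p = "\<lambda>h. E h * g (c / r h)"
        and ?p1.0 = "\<lambda>h. E h * (- c * h / r h ^ 3) *\<^sub>R g1 (c / r h) + E h * (\<i> * of_int k * of_real (a h)) * g (c / r h)"])
      show "G (x + h *\<^sub>R axis 2 1) = E h * g (c / r h)" for h
        using sc merid[of s c h]
        by (simp add: G_def x_def axis_vector3 scaleR_vector3 add_vector3 E_def r_def)
      have gr: "((\<lambda>h. g (c / r h)) has_vector_derivative (- c * h / r h ^ 3) *\<^sub>R g1 (c / r h)) (at h)" for h
        using rpos[of h] sc by (intro has_vector_derivative_compose_real g1 \<psi>) auto
      show "((\<lambda>h. E h * g (c / r h)) has_vector_derivative
        E h * (- c * h / r h ^ 3) *\<^sub>R g1 (c / r h) + E h * (\<i> * of_int k * of_real (a h)) * g (c / r h)) (at h)" for h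
        by (intro has_vector_derivative_mult gr E)
      have g1r: "((\<lambda>h. g1 (c / r h)) has_vector_derivative (- c * 0 / r 0 ^ 3) *\<^sub>R g2 (c / r 0)) (at 0)"
        using rpos[of 0] sc by (intro has_vector_derivative_compose_real g2 \<psi>) auto
      have "((\<lambda>h. E h * (- c * h / r h ^ 3) *\<^sub>R g1 (c / r h) + E h * (\<i> * of_int k * of_real (a h)) * g (c / r h))
        has_vector_derivative
        (E 0 * ((- c * 0 / r 0 ^ 3) *\<^sub>R ((- c * 0 / r 0 ^ 3) *\<^sub>R g2 (c / r 0)) + (- c / s ^ 3) *\<^sub>R g1 (c / r 0))
          + (E 0 * (\<i> * of_int k * of_real (a 0))) * ((- c * 0 / r 0 ^ 3) *\<^sub>R g1 (c / r 0)))
        + (E 0 * (\<i> * of_int k * of_real (a 0)) * ((- c * 0 / r 0 ^ 3) *\<^sub>R g1 (c / r 0))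
          + (E 0 * (\<i> * of_int k * of_real 0) + E 0 * (\<i> * of_int k * of_real (a 0)) * (\<i> * of_int k * of_real (a 0))) * g (c / r 0))) (at 0)"
        by (intro has_vector_derivative_add has_vector_derivative_mult has_vector_derivative_scaleR
            gr g1r E b' has_vector_derivative_mult_right has_vector_derivative_of_real
            a')
      then show "((\<lambda>h. E h * (- c * h / r h ^ 3) *\<^sub>R g1 (c / r h) + E h * (\<i> * of_int k * of_real (a h)) * g (c / r h))
        has_vector_derivative - (of_int k)\<^sup>2 / s\<^sup>2 * g u - (c / s ^ 3) *\<^sub>R g1 u) (at 0)"
        by (rule has_vector_derivative_eq_rhs)
          (use sc(1) ik in \<open>simp add: r0 E_def a_def u_def power2_eq_square scaleR_conv_of_real\<close>)
    qed auto
  qed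

  have x: "F x = g u"
  proof -
    have "sgn x = x" using sc(3) by (simp add: x_def sgn_vector3_unit)
    then show ?thesis using merid0[of s c] sc by (simp add: x_def u_def)
  qed
  have "laplacian G x + of_real \<mu> * F x = 0"
    using eig by (simp add: laplace_beltrami_def G_def x_def)
  then have eq: "(c / s\<^sup>2)\<^sup>2 *\<^sub>R g2 u + (2 * c / s ^ 3) *\<^sub>R g1 u
     + (- (of_int k)\<^sup>2 / s\<^sup>2 * g u - (c / s ^ 3) *\<^sub>R g1 u) + (1 / s\<^sup>2) *\<^sub>R g2 u + of_real \<mu> * g u = 0"
    unfolding laplacian_real3 d1 d2 d3 x .
  have c2: "(c / s\<^sup>2)\<^sup>2 + 1 / s\<^sup>2 = 1 / s ^ 4"
  proof -
    have "(c / s\<^sup>2)\<^sup>2 + 1 / s\<^sup>2 = (s\<^sup>2 + c\<^sup>2) / s ^ 4"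
      using sc(1) by (simp add: field_simps power_divide eval_nat_numeral)
    then show ?thesis using sc(3) by simp
  qed
  have "((c / s\<^sup>2)\<^sup>2 + 1 / s\<^sup>2) *\<^sub>R g2 u + (c / s ^ 3) *\<^sub>R g1 u
      = ((of_int k)\<^sup>2 / s\<^sup>2 - \<mu>) *\<^sub>R g u"
    using eq by (simp add: scaleR_conv_of_real algebra_simps add_eq_0_iff2)
  then have "s\<^sup>2 *\<^sub>R ((1 / s ^ 4) *\<^sub>R g2 u + (c / s ^ 3) *\<^sub>R g1 u)
      = s\<^sup>2 *\<^sub>R ((of_int k)\<^sup>2 / s\<^sup>2 - \<mu>) *\<^sub>R g u"
    unfolding c2 by simp
  moreover have "s\<^sup>2 * (1 / s ^ 4) = 1 / s\<^sup>2" "s\<^sup>2 * (c / s ^ 3) = c / s"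
    "s\<^sup>2 * ((of_int k)\<^sup>2 / s\<^sup>2 - \<mu>) = (of_int k)\<^sup>2 - \<mu> * s\<^sup>2"
    using sc(1) by (simp_all add: field_simps eval_nat_numeral)
  ultimately show ?thesis
    by (simp only: scaleR_add_right scaleR_scaleR u_def)
qed

text \<open>
  The mode is the real or the imaginary part of the eigenfunction at \<open>(1, 0, sinh t)\<close>, projected to the
  sphere.  Its behaviour at infinity expresses smoothness at the pole: near the pole the same
  values are \<open>q (1 / sinh t)\<close>, where \<open>q\<close> is the extension along rays restricted to a line in the
  plane tangent at the pole.
\<close>

lemma sector_eigenvalue_imp_regular_mode:
  assumes "sector_eigenvalue \<sigma> (int k) \<mu>"
  shows "\<exists>y z. regular_mode k \<mu> y z \<and> z 0 = \<sigma> * y 0 \<and> (\<exists>t\<ge>0. y t \<noteq> 0)"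
proof -
  obtain F x where F: "robin_solution \<sigma> \<mu> F" and sec: "in_sector (int k) F"
    and x: "x \<in> hemisphere" "F x \<noteq> 0"
    using assms by (auto simp: sector_eigenvalue_def)
  define G where "G = (\<lambda>y. F (sgn y))"
  define S where "S = {y :: real^3. 0 < y $ 3}"
  have C2: "C2_on S G" using F by (simp add: robin_solution_def S_def G_def)
  have S: "open S"
    by (auto simp: S_def intro!: open_Collect_less continuous_intros)
  have basis: "axis i 1 \<in> (Basis :: (real^3) set)" for i by (auto simp: Basis_vec_def)
  have diff: "G differentiable_on S" "\<And>b. b \<in> Basis \<Longrightarrow> partial_deriv b G differentiable_on S"
    using C2 by (auto simp: C2_on_def)
  note line = differentiable_on_line_derivative[OF _ S]

  define g where "g = (\<lambda>t. F (sgn (vector [1, 0, t])))"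
  define g1 where "g1 = (\<lambda>t. partial_deriv (axis 3 1) G (vector [1, 0, t]))"
  define g2 where "g2 = (\<lambda>t. partial_deriv (axis 3 1) (partial_deriv (axis 3 1) G) (vector [1, 0, t]))"
  have ray: "vector [1, 0, 0] + t *\<^sub>R axis 3 1 = (vector [1, 0, t] :: real^3)" for t
    by (simp add: axis_vector3 scaleR_vector3 add_vector3)
  have g1: "(g has_vector_derivative g1 t) (at t)" if "0 < t" for t
    using line[OF diff(1), of "vector [1, 0, 0]" t "axis 3 1"] that
    unfolding ray by (simp add: g_def g1_def G_def S_def)
  have g2: "(g1 has_vector_derivative g2 t) (at t)" if "0 < t" for t
    using line[OF diff(2)[OF basis], of "vector [1, 0, 0]" t "axis 3 1" 3] that
    unfolding ray by (simp add: g1_def g2_def S_def)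

  define Y where "Y = (\<lambda>t. g (sinh t))"
  define Z where "Z = (\<lambda>t. cosh t *\<^sub>R g1 (sinh t))"
  have sinh': "(sinh has_real_derivative cosh t) (at t)" for t :: real
    by (auto intro!: derivative_eq_intros)
  have cosh': "(cosh has_real_derivative sinh t) (at t)" for t :: real
    by (auto intro!: derivative_eq_intros)
  have Y': "(Y has_vector_derivative Z t) (at t)" if "0 < t" for t
    unfolding Y_def Z_def using that
    by (intro has_vector_derivative_compose_real sinh' g1) simp
  have on_hemisphere: "sgn (vector [1, 0, sinh t]) = (vector [1 / cosh t, 0, tanh t] :: real^3)"
    "(1 / cosh t)\<^sup>2 + (tanh t)\<^sup>2 = 1" for t :: real
  proof -
    show eq: "(1 / cosh t)\<^sup>2 + (tanh t)\<^sup>2 = 1"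
    proof -
      have "(cosh t)\<^sup>2 \<noteq> 0" by simp
      then show ?thesis
        unfolding tanh_def power_divide sinh_square_eq by (simp add: diff_divide_distrib)
    qed
    have "sgn (vector [1, 0, sinh t] :: real^3)
        = sgn (vector [1 / cosh t * 1, 1 / cosh t * 0, 1 / cosh t * sinh t])"
      by (rule sgn_vector3_scale[symmetric]) simp
    then show "sgn (vector [1, 0, sinh t]) = (vector [1 / cosh t, 0, tanh t] :: real^3)"
      using eq by (simp add: sgn_vector3_unit tanh_def)
  qed
  have Z': "(Z has_vector_derivative ((real k)\<^sup>2 - \<mu> / (cosh t)\<^sup>2) *\<^sub>R Y t) (at t)" if t: "0 < t" for t
  proof -
    have eig: "laplace_beltrami F (vector [1 / cosh t, 0, tanh t])
        + of_real \<mu> * F (vector [1 / cosh t, 0, tanh t]) = 0"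
      using F t on_hemisphere(2)[of t]
      by (simp add: robin_solution_def hemisphere_def equator_def norm_vector3)
    have "(1 / (1 / cosh t)\<^sup>2) *\<^sub>R g2 (tanh t / (1 / cosh t)) + (tanh t / (1 / cosh t)) *\<^sub>R g1 (tanh t / (1 / cosh t))
        = ((of_int (int k))\<^sup>2 - \<mu> * (1 / cosh t)\<^sup>2) *\<^sub>R g (tanh t / (1 / cosh t))"
      by (rule meridian_ode[OF sec C2[unfolded S_def G_def] _ _ on_hemisphere(2) eig g_def g1 g2])
        (use t in simp_all)
    then have ode: "(cosh t)\<^sup>2 *\<^sub>R g2 (sinh t) + sinh t *\<^sub>R g1 (sinh t)
        = ((real k)\<^sup>2 - \<mu> / (cosh t)\<^sup>2) *\<^sub>R g (sinh t)"
      by (simp add: tanh_def power_divide)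
    have "(Z has_vector_derivative cosh t *\<^sub>R (cosh t *\<^sub>R g2 (sinh t)) + sinh t *\<^sub>R g1 (sinh t)) (at t)"
      unfolding Z_def using t
      by (intro has_vector_derivative_scaleR has_vector_derivative_compose_real sinh' cosh' g2) simp
    then show ?thesis
      unfolding Y_def ode[symmetric] by (simp add: power2_eq_square)
  qed

  define q where "q = (\<lambda>h. G (vector [h, 0, 1]))"
  define q1 where "q1 = (\<lambda>h. partial_deriv (axis 1 1) G (vector [h, 0, 1]))"
  have pole_line: "vector [0, 0, 1] + h *\<^sub>R axis 1 1 = (vector [h, 0, 1] :: real^3)" for h
    by (simp add: axis_vector3 scaleR_vector3 add_vector3)
  have q': "(q has_vector_derivative q1 h) (at h)" for h
    using line[OF diff(1), of "vector [0, 0, 1]" h "axis 1 1"]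
    unfolding pole_line by (simp add: q_def q1_def S_def)
  have cont_q: "isCont q 0" "isCont q1 0"
  proof -
    show "isCont q 0" using q'[of 0] by (rule has_vector_derivative_continuous)
    have "\<exists>D. (q1 has_vector_derivative D) (at 0)"
      using line[OF diff(2)[OF basis], of "vector [0, 0, 1]" 0 "axis 1 1" 1]
      unfolding pole_line by (auto simp: q1_def S_def)
    then show "isCont q1 0" by (auto intro: has_vector_derivative_continuous)
  qed
  have Y_q: "Y t = q (1 / sinh t)" if "0 < t" for t
  proof -
    have "sgn (vector [sinh t * (1 / sinh t), sinh t * 0, sinh t * 1] :: real^3)
        = sgn (vector [1 / sinh t, 0, 1])"
      by (rule sgn_vector3_scale) (use that in simp)
    then show ?thesis using that by (simp add: Y_def q_def g_def G_def)
  qed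
  have Z_q: "Z t = (- cosh t / (sinh t)\<^sup>2) *\<^sub>R q1 (1 / sinh t)" if t: "0 < t" for t
  proof (rule vector_derivative_unique_at[OF Y'[OF t]])
    have "((\<lambda>t. 1 / sinh t) has_real_derivative - cosh t / (sinh t)\<^sup>2) (at t)"
      using t by (auto intro!: derivative_eq_intros simp: power2_eq_square)
    then have "((\<lambda>t. q (1 / sinh t)) has_vector_derivative (- cosh t / (sinh t)\<^sup>2) *\<^sub>R q1 (1 / sinh t)) (at t)"
      by (intro has_vector_derivative_compose_real q')
    then show "(Y has_vector_derivative (- cosh t / (sinh t)\<^sup>2) *\<^sub>R q1 (1 / sinh t)) (at t)"
      by (rule has_vector_derivative_transform_within_open[where S = "{0<..}"]) (use t Y_q in auto)
  qed
  have inv_sinh: "((\<lambda>t::real. 1 / sinh t) \<longlongrightarrow> 0) at_top"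
    by (intro tendsto_divide_0[OF tendsto_const] filterlim_at_top_imp_at_infinity sinh_real_at_top)
  have Y_lim: "(Y \<longlongrightarrow> F (vector [0, 0, 1])) at_top"
  proof -
    have "((\<lambda>t. q (1 / sinh t)) \<longlongrightarrow> q 0) at_top"
      by (rule isCont_tendsto_compose[OF cont_q(1) inv_sinh])
    then have "(Y \<longlongrightarrow> q 0) at_top"
      by (rule Lim_transform_eventually)
        (rule eventually_mono[OF eventually_gt_at_top[of 0]], simp add: Y_q)
    then show ?thesis by (simp add: q_def G_def sgn_vector3_unit)
  qed
  have Z_lim: "(Z \<longlongrightarrow> 0) at_top"
  proof -
    have "((\<lambda>t::real. inverse (tanh t)) \<longlongrightarrow> inverse 1) at_top"
      by (rule tendsto_inverse[OF tanh_real_at_top]) simp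
    then have "((\<lambda>t. (- inverse (tanh t) * (1 / sinh t)) *\<^sub>R q1 (1 / sinh t)) \<longlongrightarrow> (- inverse 1 * 0) *\<^sub>R q1 0) at_top"
      by (intro tendsto_scaleR tendsto_mult tendsto_minus inv_sinh
          isCont_tendsto_compose[OF cont_q(2) inv_sinh])
    then have "((\<lambda>t. (- cosh t / (sinh t)\<^sup>2) *\<^sub>R q1 (1 / sinh t)) \<longlongrightarrow> 0) at_top"
      by (simp add: tanh_def power2_eq_square)
    then show ?thesis
      by (rule Lim_transform_eventually)
        (rule eventually_mono[OF eventually_gt_at_top[of 0]], simp add: Z_q)
  qed
  have pole: "real k *\<^sub>R F (vector [0, 0, 1]) = 0"
    using in_sector_pole[OF sec] by (cases "k = 0") auto

  have Y_cont: "continuous_on {0..} Y"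
  proof -
    have Y: "Y = (\<lambda>t. F ((1 / cosh t) *\<^sub>R axis 1 1 + tanh t *\<^sub>R axis 3 1))"
      by (simp add: Y_def g_def on_hemisphere(1) axis_vector3 scaleR_vector3 add_vector3)
    show ?thesis
      unfolding Y
    proof (rule continuous_on_compose2[of hemisphere F])
      show "continuous_on hemisphere F" using F by (simp add: robin_solution_def)
      show "continuous_on {0..} (\<lambda>t::real. (1 / cosh t) *\<^sub>R axis 1 1 + tanh t *\<^sub>R axis 3 1 :: real^3)"
        by (intro continuous_intros) auto
      show "(\<lambda>t::real. (1 / cosh t) *\<^sub>R axis 1 1 + tanh t *\<^sub>R axis 3 1) ` {0..} \<subseteq> hemisphere"
        using on_hemisphere(2)
        by (auto simp: hemisphere_def axis_vector3 scaleR_vector3 add_vector3 norm_vector3)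
    qed
  qed
  have Y'_0: "(Y has_vector_derivative \<sigma> *\<^sub>R Y 0) (at 0 within {0..})"
  proof -
    have "axis 1 1 \<in> equator"
      by (simp add: equator_def axis_vector3 norm_vector3)
    then obtain D where D: "has_normal_derivative F D (axis 1 1)"
      and robin: "D + of_real \<sigma> * F (axis 1 1) = 0"
      using F by (auto simp: robin_solution_def)
    define N where "N = (\<lambda>t. F (cos t *\<^sub>R axis 1 1 + sin t *\<^sub>R (- axis 3 1)))"
    \<comment> \<open>The geodesic parameter of the normal derivative, as a function of \<open>t\<close>; it is negative inside the hemisphere.\<close>
    define m where "m = (\<lambda>t::real. - arctan (sinh t))"
    have Y_N: "Y t = N (m t)" for t
    proof -
      have "sqrt (1 + (sinh t)\<^sup>2) = cosh t"
        by (simp add: real_sqrt_unique cosh_square_eq)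
      then have "cos (m t) = 1 / cosh t" "sin (m t) = - tanh t"
        by (simp_all add: m_def cos_arctan sin_arctan tanh_def)
      then show ?thesis
        by (simp add: Y_def N_def g_def on_hemisphere(1) axis_vector3 scaleR_vector3 diff_vector3)
    qed
    have m': "(m has_vector_derivative -1) (at 0 within {0..})"
    proof -
      have "(m has_real_derivative -1) (at 0)"
        unfolding m_def by (auto intro!: derivative_eq_intros)
      then show ?thesis
        by (simp add: has_real_derivative_iff_has_vector_derivative has_vector_derivative_at_within)
    qed
    have "(N has_vector_derivative D) (at (m 0) within m ` {0..})"
    proof (rule has_vector_derivative_within_subset)
      show "(N has_vector_derivative D) (at (m 0) within {..0})"
        using D by (simp add: has_normal_derivative_def N_def m_def)
      show "m ` {0..} \<subseteq> {..0}" by (auto simp: m_def)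
    qed
    from vector_diff_chain_within[OF m' this]
    have "(Y has_vector_derivative -1 *\<^sub>R D) (at 0 within {0..})"
      by (simp add: o_def Y_N[symmetric])
    moreover have "F (axis 1 1) = Y 0"
      by (simp add: Y_def g_def axis_vector3 sgn_vector3_unit)
    then have "-1 *\<^sub>R D = \<sigma> *\<^sub>R Y 0"
      using robin by (simp add: scaleR_conv_of_real add_eq_0_iff2)
    ultimately show ?thesis by simp
  qed

  \<comment> \<open>The equation has real coefficients, so any real-linear functional of the complex mode is a real mode.\<close>
  have part: "regular_mode k \<mu> (\<lambda>t. P (Y t)) (\<lambda>t. if t = 0 then \<sigma> * P (Y 0) else P (Z t))"
    if P: "bounded_linear P" for P :: "complex \<Rightarrow> real"
  proof -
    define y where "y = (\<lambda>t. P (Y t))"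
    define z where "z = (\<lambda>t. if t = 0 then \<sigma> * y 0 else P (Z t))"
    define p where "p = (\<lambda>t. ((real k)\<^sup>2 - \<mu> / (cosh t)\<^sup>2) * y t)"
    have scale: "P (c *\<^sub>R w) = c * P w" for c w
      using linear_cmul[OF bounded_linear.linear[OF P]] by simp
    have P0: "P 0 = 0" using scale[of 0 0] by simp
    note P_deriv = bounded_linear.has_vector_derivative[OF P]
    have y': "(y has_real_derivative z t) (at t)" if "0 < t" for t
      using P_deriv[OF Y'[OF that]] that
      by (simp add: y_def z_def has_real_derivative_iff_has_vector_derivative)
    have "((\<lambda>t. P (Z t)) has_real_derivative p t) (at t)" if "0 < t" for t
      using P_deriv[OF Z'[OF that]]
      by (simp add: p_def y_def scale has_real_derivative_iff_has_vector_derivative)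
    then have z': "(z has_real_derivative p t) (at t)" if "0 < t" for t
      using that by (intro has_field_derivative_transform_within_open[of "\<lambda>t. P (Z t)" "p t" t "{0<..}" z])
        (auto simp: z_def)
    have cont_y: "continuous_on {0..} y"
      unfolding y_def by (rule bounded_linear.continuous_on[OF P Y_cont])
    have cont_p: "continuous_on {0..} p"
      unfolding p_def by (intro continuous_intros cont_y) auto
    have y'_0: "(y has_real_derivative \<sigma> * y 0) (at 0 within {0..})"
      using P_deriv[OF Y'_0] by (simp add: y_def scale has_real_derivative_iff_has_vector_derivative)
    have "(z \<longlongrightarrow> \<sigma> * y 0) (at_right 0)"
      by (rule derivative_continuous_at_endpoint[OF cont_y cont_p y' z' y'_0])
    then have "(z \<longlongrightarrow> z 0) (at 0 within {0..})"
      by (simp add: at_within_Ici_at_right z_def)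
    moreover have "(z \<longlongrightarrow> z t) (at t within {0..})" if "0 < t" for t
      using DERIV_isCont[OF z'[OF that]] by (auto simp: isCont_def intro: tendsto_within_subset)
    ultimately have cont_z: "continuous_on {0..} z"
      unfolding continuous_on_def by (metis atLeast_iff less_eq_real_def)
    have y_lim: "(y \<longlongrightarrow> P (F (vector [0, 0, 1]))) at_top"
      unfolding y_def by (rule bounded_linear.tendsto[OF P Y_lim])
    have "((\<lambda>t. P (Z t)) \<longlongrightarrow> 0) at_top"
      using bounded_linear.tendsto[OF P Z_lim] by (simp add: P0)
    then have z_lim: "(z \<longlongrightarrow> 0) at_top"
      by (rule Lim_transform_eventually)
        (rule eventually_mono[OF eventually_gt_at_top[of 0]], simp add: z_def)
    have "real k * P (F (vector [0, 0, 1])) = 0"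
      using pole by (simp only: scale[symmetric] P0)
    then have "regular_mode k \<mu> y z"
      unfolding regular_mode_def using cont_y cont_z y' z' y_lim z_lim by (auto simp: p_def)
    then show ?thesis by (simp only: y_def z_def)
  qed

  obtain t where t: "0 \<le> t" "Y t \<noteq> 0"
  proof -
    from in_sector_nonzero[OF sec x] show thesis
    proof
      assume "F (vector [0, 0, 1]) \<noteq> 0"
      then have "\<forall>\<^sub>F t in at_top. Y t \<noteq> 0"
        by (rule tendsto_imp_eventually_ne[OF Y_lim])
      then have "\<forall>\<^sub>F t in at_top. 0 \<le> t \<and> Y t \<noteq> 0"
        using eventually_ge_at_top[of 0] by eventually_elim simp
      then have "\<exists>t. 0 \<le> t \<and> Y t \<noteq> 0"
        using eventually_happens[of _ "at_top :: real filter"] by fastforce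
      then show thesis using that by blast
    next
      assume "\<exists>t\<ge>0. F (sgn (vector [1, 0, sinh t])) \<noteq> 0"
      then show thesis using that by (auto simp: Y_def g_def)
    qed
  qed
  then have "Re (Y t) \<noteq> 0 \<or> Im (Y t) \<noteq> 0" by (simp add: complex_eq_iff)
  then obtain P :: "complex \<Rightarrow> real" where P: "bounded_linear P" "P (Y t) \<noteq> 0"
    using bounded_linear_Re bounded_linear_Im by metis
  show ?thesis
    using part[OF P(1)] P(2) t(1)
    by (intro exI[of _ "\<lambda>t. P (Y t)"] exI[of _ "\<lambda>t. if t = 0 then \<sigma> * P (Y 0) else P (Z t)"]) auto
qed

section \<open>Simplicity of the desymmetrized spectrum\<close>

lemma sector_eigenvalues_disjoint:
  assumes "0 < \<sigma>" "k < k'" "sector_eigenvalue \<sigma> (int k) \<mu>" "sector_eigenvalue \<sigma> (int k') \<mu>"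
  shows False
  using sector_eigenvalue_imp_regular_mode[OF assms(3)]
    sector_eigenvalue_imp_regular_mode[OF assms(4)] robin_modes_disjoint[OF assms(1,2)]
  by metis

text \<open>
  Two indices with the same eigenvalue carry different sectors, because the enumeration is by
  distinct pairs.
\<close>

theorem theorem1p5:
  fixes \<sigma> :: real and ev :: "nat \<Rightarrow> real"
  assumes "\<sigma> > 0"
    and "ordered_desym_eigenvalues \<sigma> ev"
  shows "\<forall>m n. n \<noteq> m \<longrightarrow> ev m \<noteq> ev n"
proof (intro allI impI notI)
  fix m n assume "n \<noteq> m" "ev m = ev n"
  obtain k where k: "bij_betw (\<lambda>n. (k n, ev n)) UNIV (desym_spectrum \<sigma>)"
    using assms(2) by (auto simp: ordered_desym_eigenvalues_def)
  have "(k i, ev i) \<in> desym_spectrum \<sigma>" for i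
    using bij_betwE[OF k] by blast
  then have eig: "0 \<le> k i" "sector_eigenvalue \<sigma> (int (nat (k i))) (ev i)" for i
    by (auto simp: desym_spectrum_def)
  have "(k m, ev m) \<noteq> (k n, ev n)"
    using bij_betw_imp_inj_on[OF k] \<open>n \<noteq> m\<close> by (auto simp: inj_on_def)
  then have "nat (k m) < nat (k n) \<or> nat (k n) < nat (k m)"
    using \<open>ev m = ev n\<close> eig(1)[of m] eig(1)[of n] by auto
  then show False
    using sector_eigenvalues_disjoint[OF assms(1)] eig(2)[of m] eig(2)[of n] \<open>ev m = ev n\<close> by metis
qed

end
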